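(* Let $\sigma:\mathbb{T}^d\to\mathbb{R}^d$ be of class $\mathcal{C}^3$. Let $(x_0^\epsilon)_{\epsilon\in(0,\epsilon_0)}\subset\mathbb{T}^d$ and $(m_0^\epsilon)_{\epsilon\in(0,\epsilon_0)}\subset\mathbb{R}$ be deterministic, such that $x_0^\epsilon\to x_0^0$ as $\epsilon\to 0$ for some $x_0^0\in\mathbb{T}^d$ and $\sup_{\epsilon\in(0,\epsilon_0)}|m_0^\epsilon|<\infty$. Let $\Phi$ be a second-order integrator associated with $\sigma$ (as defined in the context). For all $p\in[1,\infty)$ and $T\in(0,\infty)$, with $\Delta t=T/N$, one has \[ \lim_{\epsilon\to0}\lim_{\Delta t\to0}\mathrm{d}_p\bigl(X_N^{\epsilon,\Delta t},X^\epsilon(T)\bigr)=\lim_{\Delta t\to0}\lim_{\epsilon\to0}\mathrm{d}_p\bigl(X_N^{\epsilon,\Delta t},X^\epsilon(T)\bigr)=0. \]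
   Context: $d\in\mathbb{N}$, $\mathbb{T}^d=\mathbb{R}^d/\mathbb{Z}^d$ is the torus, with distance $\mathrm{d}(\cdot,\cdot)$ induced by the Euclidean norm. For $\mathbb{T}^d$-valued random variables, $\mathrm{d}_p(\mathcal{X}_1,\mathcal{X}_2)=(\mathbb{E}[\mathrm{d}(\mathcal{X}_1,\mathcal{X}_2)^p])^{1/p}$. $\epsilon_0>0$ is an arbitrary fixed real number; the time-step size is $\Delta t=T/N$, $N\in\mathbb{N}$ (so $\Delta t\to0$ means $N\to\infty$ with $T$ fixed), and $t_n=n\Delta t$. $(\beta(t))_{t\ge0}$ is a standard real-valued Wiener process on a probability space satisfying the usual conditions, and $\Delta\beta_n=\beta(t_{n+1})-\beta(t_n)$. Multiscale SDE system: $X^\epsilon(t)\in\mathbb{T}^d$, $m^\epsilon(t)\in\mathbb{R}$ solve \[ dX^\epsilon(t)=\frac{\sigma(X^\epsilon(t))m^\epsilon(t)}{\epsilon}dt,\qquad dm^\epsilon(t)=-\frac{m^\epsilon(t)}{\epsilon^2}dt+\frac1\epsilon d\beta(t), \] with $X^\epsilon(0)=x_0^\epsilon$, $m^\epsilon(0)=m_0^\epsilon$. Flow map: $\varphi:\mathbb{R}\times\mathbb{T}^d\to\mathbb{T}^d$ is the flow of the ODE $\dot x=\sigma(x)$, i.e. $\partial_t\varphi(t,x)=\sigma(\varphi(t,x))$, $\varphi(0,x)=x$. Second-order integrator: a map $\Phi:\mathbb{R}\times\mathbb{T}^d\to\mathbb{T}^d$ of class $\mathcal{C}^3$ for which there exists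 $C\in(0,\infty)$ such that: (i) $\mathrm{d}(\Phi(t,x),\varphi(t,x))\le C|t|^3e^{C|t|}$ for all $t\in\mathbb{R}$, $x\in\mathbb{T}^d$; (ii) $\mathrm{d}(\Phi(t_2,x_2),\Phi(t_1,x_1))\le C(|t_2-t_1|+\mathrm{d}(x_2,x_1))e^{C(|t_1|+|t_2|)}$ for all $t_1,t_2\in\mathbb{R}$, $x_1,x_2\in\mathbb{T}^d$; (iii) for all $i,j\in\{0,1,2,3\}$ with $i+j\le3$ and all $t\in\mathbb{R}$, $\sup_{x\in\mathbb{T}^d}|\partial_t^i\partial_x^j\Phi(t,x)|\le Ce^{C|t|}$ (for $i=j=0$, where $\Phi$ is torus-valued, $|\Phi(t,x)|$ is read as $\mathrm{d}(\Phi(t,x),0)$, so the bound is automatic). Numerical scheme: \[ X_{n+1}^{\epsilon,\Delta t}=\Phi\Bigl(\frac{\Delta t\,m_{n+1}^{\epsilon,\Delta t}}{\epsilon},X_n^{\epsilon,\Delta t}\Bigr),\qquad m_{n+1}^{\epsilon,\Delta t}=m_n^{\epsilon,\Delta t}-\frac{\Delta t}{\epsilon^2}m_{n+1}^{\epsilon,\Delta t}+\frac{\Delta\beta_n}{\epsilon}, \] with $X_0^{\epsilon,\Delta t}=x_0^\epsilon$, $m_0^{\epsilon,\Delta t}=m_0^\epsilon$. *)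

theory Defs
  imports "HOL-Probability.Probability"
begin

section \<open>The torus\<close>

quotient_type 'n torus = "real ^ 'n" / "\<lambda>x y. \<forall>i. x $ i - y $ i \<in> \<int>"
  morphisms rep_torus torus_of
proof (rule equivpI)
  show "reflp (\<lambda>x y :: real ^ 'n. \<forall>i. x $ i - y $ i \<in> \<int>)"
    by (rule reflpI) simp
  show "symp (\<lambda>x y :: real ^ 'n. \<forall>i. x $ i - y $ i \<in> \<int>)"
    by (rule sympI) (metis Ints_minus minus_diff_eq)
  show "transp (\<lambda>x y :: real ^ 'n. \<forall>i. x $ i - y $ i \<in> \<int>)"
  proof (rule transpI, intro allI)
    fix x y z :: "real ^ 'n" and i
    assume "\<forall>i. x $ i - y $ i \<in> \<int>" "\<forall>i. y $ i - z $ i \<in> \<int>"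
    then have "(x $ i - y $ i) + (y $ i - z $ i) \<in> \<int>"
      by (intro Ints_add) auto
    then show "x $ i - z $ i \<in> \<int>" by simp
  qed
qed

lemma torus_of_eq_iff: "torus_of x = torus_of y \<longleftrightarrow> (\<forall>i. x $ i - y $ i \<in> \<int>)"
  by (rule torus.abs_eq_iff)

lemma torus_of_surj: "\<exists>x. torus_of x = a"
  by (rule exI, rule Quotient3_abs_rep[OF Quotient3_torus])

instantiation torus :: (finite) zero
begin
definition zero_torus :: "'a torus" where "0 = torus_of 0"
instance ..
end

instantiation torus :: (finite) metric_space
begin

definition dist_torus :: "'a torus \<Rightarrow> 'a torus \<Rightarrow> real" where
  "dist a b = Inf {norm (x - y) | x y. torus_of x = a \<and> torus_of y = b}"

definition uniformity_torus :: "('a torus \<times> 'a torus) filter" where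
  "(uniformity :: ('a torus \<times> 'a torus) filter) = (INF e\<in>{0 <..}. principal {(x, y). dist x y < e})"

definition open_torus :: "'a torus set \<Rightarrow> bool" where
  "open (U :: 'a torus set) \<longleftrightarrow> (\<forall>x\<in>U. eventually (\<lambda>(x', y). x' = x \<longrightarrow> y \<in> U) uniformity)"

instance
proof
  let ?D = "\<lambda>a b :: 'a torus. {norm (x - y) | x y. torus_of x = a \<and> torus_of y = b}"
  have bdd: "bdd_below (?D a b)" for a b
    by (rule bdd_belowI[of _ 0]) auto
  have ne: "?D a b \<noteq> {}" for a b
    using torus_of_surj[of a] torus_of_surj[of b] by blast
  have approx: "\<exists>x y. torus_of x = a \<and> torus_of y = b \<and> norm (x - y) < r"
    if "dist a b < r" for a b :: "'a torus" and r
    using that cInf_less_iff[OF ne bdd, of a b r] unfolding dist_torus_def by blast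
  have le: "dist (torus_of x) (torus_of y) \<le> norm (x - y)" for x y :: "real ^ 'a"
    unfolding dist_torus_def by (rule cInf_lower[OF _ bdd]) blast
  have nonneg: "0 \<le> dist a b" for a b :: "'a torus"
    unfolding dist_torus_def by (rule cInf_greatest[OF ne]) auto
  have trans: "torus_of (x + (z - y)) = torus_of x" if "torus_of z = torus_of y"
    for x y z :: "real ^ 'a"
    using that by (auto simp: torus_of_eq_iff)
  show "uniformity = (INF e\<in>{0 <..}. principal {(x :: 'a torus, y). dist x y < e})"
    by (rule uniformity_torus_def)
  show "open U \<longleftrightarrow> (\<forall>x\<in>U. eventually (\<lambda>(x', y). x' = x \<longrightarrow> y \<in> U) uniformity)"
    for U :: "'a torus set"
    by (rule open_torus_def)
  show "dist a b = 0 \<longleftrightarrow> a = b" for a b :: "'a torus"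
  proof
    assume "a = b"
    moreover obtain x where "torus_of x = a" using torus_of_surj by blast
    ultimately show "dist a b = 0" using le[of x x] nonneg[of a b] by auto
  next
    assume 0: "dist a b = 0"
    obtain u v where uv: "torus_of u = a" "torus_of v = b"
      using torus_of_surj by metis
    show "a = b"
    proof (rule ccontr)
      assume "a \<noteq> b"
      then obtain i where i: "u $ i - v $ i \<notin> \<int>"
        using uv torus_of_eq_iff by blast
      define r where "r = min (frac (u $ i - v $ i)) (1 - frac (u $ i - v $ i))"
      have "r > 0" using i frac_lt_1[of "u $ i - v $ i"] by (simp add: r_def)
      with 0 obtain x y where xy: "torus_of x = a" "torus_of y = b" "norm (x - y) < r"
        using approx[of a b r] by auto
      have "x $ i - u $ i \<in> \<int>" "v $ i - y $ i \<in> \<int>"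
        using xy uv torus_of_eq_iff by metis+
      then have "(x $ i - u $ i) + (v $ i - y $ i) \<in> \<int>" by (rule Ints_add)
      then obtain k where k: "(x $ i - u $ i) + (v $ i - y $ i) = of_int k"
        by (auto elim: Ints_cases)
      have "\<bar>(x - y) $ i\<bar> < r"
        using xy(3) component_le_norm_cart[of "x - y" i] by linarith
      then have "\<bar>(u $ i - v $ i) + of_int k\<bar> < r" using k by simp
      moreover have "u $ i - v $ i = of_int \<lfloor>u $ i - v $ i\<rfloor> + frac (u $ i - v $ i)"
        by (simp add: frac_def)
      ultimately have *: "\<bar>frac (u $ i - v $ i) + of_int (\<lfloor>u $ i - v $ i\<rfloor> + k)\<bar> < r"
        by (simp add: add_ac)
      show False
      proof (cases "\<lfloor>u $ i - v $ i\<rfloor> + k \<ge> 0")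
        case True
        then have "real_of_int (\<lfloor>u $ i - v $ i\<rfloor> + k) \<ge> 0" by simp
        then show ?thesis using * unfolding r_def by linarith
      next
        case False
        then have "\<lfloor>u $ i - v $ i\<rfloor> + k \<le> -1" by simp
        then have "real_of_int (\<lfloor>u $ i - v $ i\<rfloor> + k) \<le> -1"
          using of_int_le_iff[where 'a = real] by fastforce
        then show ?thesis using * unfolding r_def by linarith
      qed
    qed
  qed
  show "dist a b \<le> dist a c + dist b c" for a b c :: "'a torus"
  proof (rule field_le_epsilon)
    fix e :: real assume "e > 0"
    then obtain x z where xz: "torus_of x = a" "torus_of z = c" "norm (x - z) < dist a c + e/2"
      using approx[of a c "dist a c + e/2"] by auto
    obtain y z' where yz: "torus_of y = b" "torus_of z' = c" "norm (y - z') < dist b c + e/2"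
      using approx[of b c "dist b c + e/2"] \<open>e > 0\<close> by auto
    have "torus_of (y + (z - z')) = b" using trans[of z z' y] xz yz by simp
    then have "dist a b \<le> norm (x - (y + (z - z')))" using le xz by metis
    also have "\<dots> = norm ((x - z) - (y - z'))" by (simp add: algebra_simps)
    also have "\<dots> \<le> norm (x - z) + norm (y - z')" by (rule norm_triangle_ineq4)
    finally show "dist a b \<le> dist a c + dist b c + e" using xz yz by simp
  qed
qed

end


section \<open>Differential calculus\<close>

primrec C_k :: "nat \<Rightarrow> ('a::real_normed_vector \<Rightarrow> 'b::real_normed_vector) \<Rightarrow> bool" where
  "C_k 0 f \<longleftrightarrow> continuous_on UNIV f"
| "C_k (Suc k) f \<longleftrightarrow>
     (\<forall>x. f differentiable (at x)) \<and> (\<forall>v. C_k k (\<lambda>x. frechet_derivative f (at x) v))"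

text \<open>The directions in the list are used from left to right, the head being applied first.\<close>

primrec dir_derivs :: "'a list \<Rightarrow> ('a::real_normed_vector \<Rightarrow> 'b::real_normed_vector) \<Rightarrow> 'a \<Rightarrow> 'b" where
  "dir_derivs [] f = f"
| "dir_derivs (v # vs) f = dir_derivs vs (\<lambda>x. frechet_derivative f (at x) v)"

text \<open>
  The local inverses of \<^const>\<open>torus_of\<close> are the charts of the torus, so the derivative of a
  torus-valued map at a point is the derivative of any local lift \<open>g\<close> that is differentiable
  (hence continuous) at that point.  It takes values in \<open>\<real>\<^sup>d\<close>, the tangent space at every
  point of the torus.
\<close>

definition has_torus_derivative ::
  "('a::real_normed_vector \<Rightarrow> 'n::finite torus) \<Rightarrow> ('a \<Rightarrow> real ^ 'n) \<Rightarrow> 'a \<Rightarrow> 'a set \<Rightarrow> bool" where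
  "has_torus_derivative f D x S \<longleftrightarrow>
     (\<exists>g. (g has_derivative D) (at x within S) \<and> f x = torus_of (g x) \<and>
          (\<forall>\<^sub>F y in at x within S. f y = torus_of (g y)))"

definition torus_frechet_derivative ::
  "('a::real_normed_vector \<Rightarrow> 'n::finite torus) \<Rightarrow> 'a \<Rightarrow> 'a \<Rightarrow> real ^ 'n" where
  "torus_frechet_derivative f x = (SOME D. has_torus_derivative f D x UNIV)"

primrec torus_C_k :: "nat \<Rightarrow> ('a::real_normed_vector \<Rightarrow> 'n::finite torus) \<Rightarrow> bool" where
  "torus_C_k 0 f \<longleftrightarrow> continuous_on UNIV f"
| "torus_C_k (Suc k) f \<longleftrightarrow>
     (\<forall>x. \<exists>D. has_torus_derivative f D x UNIV) \<and>
     (\<forall>v. C_k k (\<lambda>x. torus_frechet_derivative f x v))"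

definition torus_dir_derivs ::
  "'a \<Rightarrow> 'a list \<Rightarrow> ('a::real_normed_vector \<Rightarrow> 'n::finite torus) \<Rightarrow> 'a \<Rightarrow> real ^ 'n" where
  "torus_dir_derivs v vs f = dir_derivs vs (\<lambda>x. torus_frechet_derivative f x v)"


section \<open>Flow and second-order integrators\<close>

definition torus_flow ::
  "('n::finite torus \<Rightarrow> real ^ 'n) \<Rightarrow> (real \<Rightarrow> 'n torus \<Rightarrow> 'n torus) \<Rightarrow> bool" where
  "torus_flow \<sigma> \<phi> \<longleftrightarrow>
     (\<forall>x. \<phi> 0 x = x) \<and>
     (\<forall>t x. has_torus_derivative (\<lambda>s. \<phi> s x) (\<lambda>h. h *\<^sub>R \<sigma> (\<phi> t x)) t UNIV)"

text \<open>
  A map on \<open>\<real> \<times> \<T>\<^sup>d\<close> is differentiated through its pullback to \<open>\<real> \<times> \<real>\<^sup>d\<close>.  The norm of the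
  \<open>j\<close>-linear map \<open>\<partial>\<^sub>t\<^sup>i \<partial>\<^sub>x\<^sup>j \<Phi>(t, x)\<close> is the operator norm, expressed as a bound for all directions
  \<open>vs\<close> in the unit ball.
\<close>

definition torus_pullback ::
  "(real \<Rightarrow> 'n::finite torus \<Rightarrow> 'n torus) \<Rightarrow> real \<times> (real ^ 'n) \<Rightarrow> 'n torus" where
  "torus_pullback \<Phi> = (\<lambda>(t, y). \<Phi> t (torus_of y))"

definition mixed_deriv_bound ::
  "(real \<Rightarrow> 'n::finite torus \<Rightarrow> 'n torus) \<Rightarrow> nat \<Rightarrow> nat \<Rightarrow> real \<Rightarrow> real ^ 'n \<Rightarrow> real \<Rightarrow> bool" where
  "mixed_deriv_bound \<Phi> i j t y B \<longleftrightarrow>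
     (\<forall>vs. length vs = j \<longrightarrow> (\<forall>v\<in>set vs. norm v \<le> 1) \<longrightarrow>
        (case map (Pair 0) vs @ replicate i (1, 0) of
           [] \<Rightarrow> dist (\<Phi> t (torus_of y)) 0 \<le> B
         | w # ws \<Rightarrow> norm (torus_dir_derivs w ws (torus_pullback \<Phi>) (t, y)) \<le> B))"

definition second_order_integrator ::
  "(real \<Rightarrow> 'n::finite torus \<Rightarrow> 'n torus) \<Rightarrow> (real \<Rightarrow> 'n torus \<Rightarrow> 'n torus) \<Rightarrow> bool" where
  "second_order_integrator \<phi> \<Phi> \<longleftrightarrow>
     torus_C_k 3 (torus_pullback \<Phi>) \<and>
     (\<exists>C>0.
        (\<forall>t x. dist (\<Phi> t x) (\<phi> t x) \<le> C * \<bar>t\<bar> ^ 3 * exp (C * \<bar>t\<bar>)) \<and>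
        (\<forall>t1 t2 x1 x2. dist (\<Phi> t2 x2) (\<Phi> t1 x1)
            \<le> C * (\<bar>t2 - t1\<bar> + dist x2 x1) * exp (C * (\<bar>t1\<bar> + \<bar>t2\<bar>))) \<and>
        (\<forall>i j t y. i + j \<le> 3 \<longrightarrow> mixed_deriv_bound \<Phi> i j t y (C * exp (C * \<bar>t\<bar>))))"


section \<open>Wiener process, multiscale system and scheme\<close>

text \<open>The time index set is \<open>[0, \<infinity>)\<close>; values at negative times are never used.\<close>

definition usual_conditions :: "'w measure \<Rightarrow> (real \<Rightarrow> 'w measure) \<Rightarrow> bool" where
  "usual_conditions M F \<longleftrightarrow>
     prob_space M \<and> complete_measure M \<and>
     (\<forall>t\<ge>0. subalgebra M (F t)) \<and>
     (\<forall>s t. 0 \<le> s \<longrightarrow> s \<le> t \<longrightarrow> sets (F s) \<subseteq> sets (F t)) \<and>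
     null_sets M \<subseteq> sets (F 0) \<and>
     (\<forall>t\<ge>0. sets (F t) = (\<Inter>s\<in>{t<..}. sets (F s)))"

definition wiener_process ::
  "'w measure \<Rightarrow> (real \<Rightarrow> 'w measure) \<Rightarrow> (real \<Rightarrow> 'w \<Rightarrow> real) \<Rightarrow> bool" where
  "wiener_process M F \<beta> \<longleftrightarrow>
     (\<forall>t\<ge>0. \<beta> t \<in> borel_measurable (F t)) \<and>
     (AE \<omega> in M. \<beta> 0 \<omega> = 0 \<and> continuous_on {0..} (\<lambda>t. \<beta> t \<omega>)) \<and>
     (\<forall>s t. 0 \<le> s \<longrightarrow> s < t \<longrightarrow>
        distributed M lborel (\<lambda>\<omega>. \<beta> t \<omega> - \<beta> s \<omega>) (normal_density 0 (sqrt (t - s))) \<and>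
        prob_space.indep_set M (sets (F s))
          (sets (vimage_algebra (space M) (\<lambda>\<omega>. \<beta> t \<omega> - \<beta> s \<omega>) borel)))"

text \<open>
  The noise is additive, so its stochastic integral is the increment of \<open>\<beta>\<close>; the equation
  for \<open>X\<close> has no noise term and is a pathwise differential equation on the torus.
\<close>

definition multiscale_solution ::
  "'w measure \<Rightarrow> (real \<Rightarrow> 'w measure) \<Rightarrow> (real \<Rightarrow> 'w \<Rightarrow> real) \<Rightarrow> ('n::finite torus \<Rightarrow> real ^ 'n) \<Rightarrow>
   real \<Rightarrow> 'n torus \<Rightarrow> real \<Rightarrow> (real \<Rightarrow> 'w \<Rightarrow> 'n torus) \<Rightarrow> (real \<Rightarrow> 'w \<Rightarrow> real) \<Rightarrow> bool" where
  "multiscale_solution M F \<beta> \<sigma> \<epsilon> x0 m0 X m \<longleftrightarrow>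
     (\<forall>t\<ge>0. X t \<in> F t \<rightarrow>\<^sub>M borel \<and> m t \<in> F t \<rightarrow>\<^sub>M borel) \<and>
     (AE \<omega> in M.
        X 0 \<omega> = x0 \<and>
        (\<forall>t\<ge>0. has_torus_derivative (\<lambda>s. X s \<omega>)
                  (\<lambda>h. h *\<^sub>R ((m t \<omega> / \<epsilon>) *\<^sub>R \<sigma> (X t \<omega>))) t {0..}) \<and>
        continuous_on {0..} (\<lambda>t. m t \<omega>) \<and>
        (\<forall>t\<ge>0. m t \<omega> = m0 - integral {0..t} (\<lambda>s. m s \<omega> / \<epsilon>\<^sup>2) + (\<beta> t \<omega> - \<beta> 0 \<omega>) / \<epsilon>))"

definition scheme_solution ::
  "'w measure \<Rightarrow> (real \<Rightarrow> 'w \<Rightarrow> real) \<Rightarrow> (real \<Rightarrow> 'n::finite torus \<Rightarrow> 'n torus) \<Rightarrow> real \<Rightarrow> real \<Rightarrow>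
   'n torus \<Rightarrow> real \<Rightarrow> (nat \<Rightarrow> 'w \<Rightarrow> 'n torus) \<Rightarrow> (nat \<Rightarrow> 'w \<Rightarrow> real) \<Rightarrow> bool" where
  "scheme_solution M \<beta> \<Phi> \<epsilon> \<Delta>t x0 m0 X m \<longleftrightarrow>
     (\<forall>\<omega>\<in>space M. X 0 \<omega> = x0 \<and> m 0 \<omega> = m0 \<and>
        (\<forall>n. X (Suc n) \<omega> = \<Phi> (\<Delta>t * m (Suc n) \<omega> / \<epsilon>) (X n \<omega>) \<and>
             m (Suc n) \<omega> = m n \<omega> - \<Delta>t / \<epsilon>\<^sup>2 * m (Suc n) \<omega>
               + (\<beta> (real (Suc n) * \<Delta>t) \<omega> - \<beta> (real n * \<Delta>t) \<omega>) / \<epsilon>))"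

definition torus_dp ::
  "'w measure \<Rightarrow> real \<Rightarrow> ('w \<Rightarrow> 'n::finite torus) \<Rightarrow> ('w \<Rightarrow> 'n torus) \<Rightarrow> real" where
  "torus_dp M p X Y = (\<integral>\<omega>. dist (X \<omega>) (Y \<omega>) powr p \<partial>M) powr (1 / p)"

end

theory Submission
  imports Defs
begin

text \<open>
  Integrating the velocity equation gives
  \<open>X(T) = \<phi> (\<epsilon> (m\<^sub>0 - m(T)) + \<beta>(T) - \<beta>(0), x\<^sub>0)\<close>, so both limits can be taken along a fixed
  noise path; torus distances are bounded, and dominated convergence then yields the limits of \<open>d\<^sub>p\<close>.
  For fixed \<open>\<epsilon>\<close> the velocity scheme converges uniformly and its time steps are \<open>O(\<Delta>t)\<close>. As
  \<open>\<epsilon> \<rightarrow> 0\<close>, the relaxation gives \<open>\<epsilon> m(T) \<rightarrow> 0\<close> and the steps of the scheme tend to the Brownian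
  increments. The limit scheme then satisfies
  \<open>d (X\<^sub>N, \<phi> (\<beta>(T) - \<beta>(0), x)) \<le> K(\<omega>) \<Sum> \<bar>\<Delta>\<beta>\<^sub>n\<bar>\<^sup>3\<close>, whose sum tends to \<open>0\<close> in \<open>L\<^sup>1\<close>, hence almost
  surely along a subsequence of any subsequence.
\<close>

section \<open>The torus as a metric space\<close>

text \<open>The noise is scalar and every velocity is a multiple of the single field \<sigma>, so
  the position moves along one orbit of the flow and sees the noise only through the time integral
  of its speed. This is why a driver that is merely continuous can be treated path by path, with no
  stochastic integral. The order of the integrator enters through the local error |t|^3. A local
  error |t|^2 would leave the sum of squared increments in the estimate, which tends to T and not to
  zero. Continuity of a path does not force its cubic sums to vanish; Gaussian third moments do so
  in mean. This is the origin of the L^1 argument and of the subsequences. Limits in \<epsilon> are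
  taken along sequences, because the null set on which the equations may fail depends on \<epsilon>.
  The torus has no linear structure, so differential inequalities are proved for lifts to
  \<open>real ^ 'n\<close> and then projected.\<close>

lemma dist_torus_of_le: "dist (torus_of x) (torus_of y) \<le> norm (x - y)"
  unfolding dist_torus_def by (rule cInf_lower) (auto intro!: bdd_belowI[of _ 0])

text \<open>Representatives that are optimal up to a slack stand in for minimisers of the infimum in
  \<open>dist\<close>. Where a sharp bound is wanted, the slack is removed by
  \<open>field_le_epsilon\<close>.\<close>

lemma dist_torus_lessE:
  assumes "dist a b < r"
  obtains x y where "torus_of x = a" "torus_of y = b" "norm (x - y) < r"
proof -
  let ?D = "{norm (x - y) | x y. torus_of x = a \<and> torus_of y = b}"
  have "?D \<noteq> {}"
    using torus_of_surj[of a] torus_of_surj[of b] by blast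
  moreover have "bdd_below ?D"
    by (rule bdd_belowI[of _ 0]) auto
  ultimately show thesis
    using assms cInf_less_iff[of ?D r] that unfolding dist_torus_def by blast
qed

lemma torus_of_add_eq:
  assumes "torus_of u = torus_of v"
  shows "torus_of (x + (u - v)) = torus_of x"
  using assms by (auto simp: torus_of_eq_iff)

lemma torus_of_diff_eq:
  assumes "torus_of u = torus_of v"
  shows "torus_of (x - u) = torus_of (x - v)"
  unfolding torus_of_eq_iff
proof
  fix i
  have "v $ i - u $ i \<in> \<int>"
    using assms[symmetric] by (simp add: torus_of_eq_iff)
  then show "(x - u) $ i - (x - v) $ i \<in> \<int>" by simp
qed

lemma torus_of_rep_torus: "torus_of (rep_torus a) = a"
  by (rule Quotient3_abs_rep[OF Quotient3_torus])

lemma continuous_on_torus_of: "continuous_on S torus_of"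
  by (rule continuous_onI) (metis dist_torus_of_le dist_norm le_less_trans less_imp_le)

text \<open>Shifting a near-optimal pair by the lattice vector \<open>x - v\<close> moves the
  representative of \<open>z\<close> close to \<open>x\<close> itself. Openness carries a countable
  basis from the covering space to the torus.\<close>

lemma open_image_torus_of:
  assumes "open U"
  shows "open (torus_of ` U)"
  unfolding open_dist
proof clarify
  fix x assume "x \<in> U"
  then obtain e where e: "e > 0" "ball x e \<subseteq> U"
    using assms openE by blast
  have "z \<in> torus_of ` U" if less: "dist z (torus_of x) < e" for z
  proof -
    obtain u v where uv: "torus_of u = z" "torus_of v = torus_of x" "norm (u - v) < e"
      using less by (rule dist_torus_lessE)
    have "torus_of (u + (x - v)) = z"
      using torus_of_add_eq[of x v u] uv by simp
    moreover have "u + (x - v) \<in> U"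
      using e uv(3) by (auto simp: dist_norm norm_minus_commute algebra_simps)
    ultimately show ?thesis by (metis imageI)
  qed
  then show "\<exists>e>0. \<forall>y. dist y (torus_of x) < e \<longrightarrow> y \<in> torus_of ` U"
    using e by blast
qed

text \<open>A countable basis makes \<open>dist\<close> and jointly continuous maps of two
  torus-valued random variables Borel measurable.\<close>

instance torus :: (finite) second_countable_topology
proof
  obtain B :: "(real ^ 'a) set set" where B: "countable B" "topological_basis B"
    using ex_countable_basis by blast
  let ?B = "(\<lambda>U. (torus_of ` U :: 'a torus set)) ` B"
  have "topological_basis ?B"
  proof (rule topological_basisI)
    fix V assume "V \<in> ?B"
    then show "open V"
      using B open_image_torus_of topological_basis_open by blast
  next
    fix W :: "'a torus set" and a
    assume W: "open W" "a \<in> W"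
    obtain x where x: "torus_of x = a" using torus_of_surj by blast
    have "open (torus_of -` W)"
      using W continuous_on_torus_of continuous_on_open_vimage[of UNIV torus_of] by auto
    then obtain U where "U \<in> B" "x \<in> U" "U \<subseteq> torus_of -` W"
      using B W x by (meson topological_basisE vimageI2)
    then show "\<exists>B'\<in>?B. a \<in> B' \<and> B' \<subseteq> W"
      using x by (intro bexI[of _ "torus_of ` U"]) auto
  qed
  then show "\<exists>B::'a torus set set. countable B \<and> open = generate_topology B"
    using B topological_basis_imp_subbasis by blast
qed

lemma torus_of_representative:
  obtains y where "y \<in> cbox 0 1" "torus_of y = torus_of x"
proof
  let ?y = "\<chi> i. frac (x $ i)"
  show "?y \<in> cbox 0 1"
    by (auto simp: mem_box_cart less_imp_le[OF frac_lt_1])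
  show "torus_of ?y = torus_of x"
    by (auto simp: torus_of_eq_iff frac_def)
qed

text \<open>The unit cube is a bounded set of representatives. \<open>D\<close> later supplies the
  dominating constant.\<close>

lemma torus_bounded:
  obtains D where "\<And>a b :: 'n::finite torus. dist a b \<le> D"
proof -
  have "bounded (cbox 0 1 :: (real ^ 'n) set)" by simp
  then obtain D where D: "\<And>x. x \<in> cbox 0 1 \<Longrightarrow> norm (x :: real ^ 'n) \<le> D"
    unfolding bounded_iff by blast
  have "dist a b \<le> 2 * D" for a b :: "'n torus"
  proof -
    obtain x y where "torus_of x = a" "x \<in> cbox 0 1" "torus_of y = b" "y \<in> cbox 0 1"
      using torus_of_surj torus_of_representative by metis
    then show ?thesis
      using dist_torus_of_le[of x y] D[of x] D[of y] norm_triangle_ineq4[of x y] by auto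
  qed
  then show thesis by (rule that)
qed

section \<open>Torus-valued derivatives\<close>

lemma has_torus_derivative_subset:
  assumes "has_torus_derivative f D x S" "U \<subseteq> S"
  shows "has_torus_derivative f D x U"
  using assms unfolding has_torus_derivative_def
  by (meson at_le filter_leD has_derivative_subset)

lemma has_torus_derivative_continuous:
  assumes "has_torus_derivative f D x S"
  shows "(f \<longlongrightarrow> f x) (at x within S)"
proof -
  obtain g where g: "(g has_derivative D) (at x within S)" "f x = torus_of (g x)"
    "\<forall>\<^sub>F y in at x within S. f y = torus_of (g y)"
    using assms unfolding has_torus_derivative_def by blast
  have "(g \<longlongrightarrow> g x) (at x within S)"
    using has_derivative_continuous[OF g(1)] by (simp add: continuous_within)
  then have "((\<lambda>y. torus_of (g y)) \<longlongrightarrow> torus_of (g x)) (at x within S)"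
    using continuous_on_tendsto_compose[OF continuous_on_torus_of[of UNIV]] by simp
  then show ?thesis
    unfolding g(2) by (rule Lim_transform_eventually) (use g(3) in eventually_elim, simp)
qed

lemma has_torus_derivative_compose:
  assumes f: "has_torus_derivative f D (A t) UNIV"
    and A: "(A has_derivative A') (at t within S)"
  shows "has_torus_derivative (\<lambda>s. f (A s)) (\<lambda>h. D (A' h)) t S"
proof -
  obtain g where g: "(g has_derivative D) (at (A t))" "f (A t) = torus_of (g (A t))"
    "\<forall>\<^sub>F y in at (A t). f y = torus_of (g y)"
    using f unfolding has_torus_derivative_def by blast
  have "\<forall>\<^sub>F y in nhds (A t). f y = torus_of (g y)"
    using g eventually_nhds_conv_at by blast
  moreover have "(A \<longlongrightarrow> A t) (at t within S)"
    using has_derivative_continuous[OF A] by (simp add: continuous_within)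
  ultimately have "\<forall>\<^sub>F s in at t within S. f (A s) = torus_of (g (A s))"
    by (rule eventually_compose_filterlim)
  moreover have "((\<lambda>s. g (A s)) has_derivative (\<lambda>h. D (A' h))) (at t within S)"
    by (rule has_derivative_compose[OF A g(1)])
  ultimately show ?thesis
    using g(2) unfolding has_torus_derivative_def by blast
qed

text \<open>The difference of a path and its candidate lift has zero metric derivative, and so its
  distance to the initial value is a real function with zero derivative.\<close>

lemma torus_lift_unique:
  fixes f :: "real \<Rightarrow> 'n::finite torus"
  assumes S: "convex S" "t\<^sub>0 \<in> S" "t \<in> S"
    and f: "\<And>s. s \<in> S \<Longrightarrow> has_torus_derivative f (\<lambda>h. h *\<^sub>R v s) s S"
    and F: "\<And>s. s \<in> S \<Longrightarrow> (F has_vector_derivative v s) (at s within S)"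
    and "f t\<^sub>0 = torus_of (F t\<^sub>0)"
  shows "f t = torus_of (F t)"
proof -
  \<comment> \<open>The representative \<open>rep_torus (f s)\<close> may jump with
    \<open>s\<close>, but the class of the difference does not depend on the choice.\<close>
  define h where "h s = torus_of (F s - rep_torus (f s))" for s
  define u where "u s = dist (h s) (h t\<^sub>0)" for s
  have h_eq: "h s = torus_of (F s - y)" if "f s = torus_of y" for s y
    unfolding h_def using that torus_of_diff_eq torus_of_rep_torus by metis
  have "(u has_derivative (\<lambda>_. 0)) (at s within S)" if s: "s \<in> S" for s
  proof -
    obtain g where g: "(g has_derivative (\<lambda>h. h *\<^sub>R v s)) (at s within S)" "f s = torus_of (g s)"
      "\<forall>\<^sub>F r in at s within S. f r = torus_of (g r)"
      using f[OF s] unfolding has_torus_derivative_def by blast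
    let ?w = "\<lambda>r. F r - g r"
    have "(?w has_derivative (\<lambda>h. h *\<^sub>R v s - h *\<^sub>R v s)) (at s within S)"
      using F[OF s] g(1) unfolding has_vector_derivative_def by (intro derivative_intros)
    then have w: "((\<lambda>r. norm (?w r - ?w s) / norm (r - s)) \<longlongrightarrow> 0) (at s within S)"
      unfolding has_derivative_iff_norm by simp
    have "\<forall>\<^sub>F r in at s within S. norm ((u r - u s - 0) / norm (r - s)) \<le> norm (?w r - ?w s) / norm (r - s)"
      using g(3)
    proof eventually_elim
      case (elim r)
      have "\<bar>u r - u s\<bar> \<le> dist (h r) (h s)"
        unfolding u_def using dist_triangle2[of "h r" "h t\<^sub>0" "h s"]
          dist_triangle2[of "h s" "h t\<^sub>0" "h r"] dist_triangle[of "h r" "h t\<^sub>0" "h s"]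
          dist_triangle[of "h s" "h t\<^sub>0" "h r"]
        by (simp add: dist_commute abs_le_iff)
      also have "\<dots> \<le> norm (?w r - ?w s)"
        using dist_torus_of_le h_eq[OF elim] h_eq[OF g(2)] by metis
      finally show ?case
        by (simp add: divide_right_mono)
    qed
    then have "((\<lambda>r. (u r - u s - 0) / norm (r - s)) \<longlongrightarrow> 0) (at s within S)"
      by (rule Lim_null_comparison[OF _ w])
    from tendsto_norm_zero[OF this] show ?thesis
      unfolding has_derivative_iff_norm by (simp add: bounded_linear_zero)
  qed
  then have "\<exists>c. \<forall>s\<in>S. u s = c"
    by (intro has_derivative_zero_constant[OF S(1)]) auto
  moreover have "u t\<^sub>0 = 0" by (simp add: u_def)
  ultimately have "h t = h t\<^sub>0"
    using S by (metis u_def zero_less_dist_iff less_irrefl)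
  also have "\<dots> = torus_of (F t\<^sub>0 - F t\<^sub>0)"
    using assms(6) by (rule h_eq)
  finally have "torus_of (F t - rep_torus (f t)) = torus_of 0"
    by (simp add: h_def)
  then have "torus_of (F t - (F t - rep_torus (f t))) = torus_of (F t - 0)"
    by (rule torus_of_diff_eq)
  then show ?thesis by (simp add: torus_of_rep_torus)
qed

text \<open>The primitive of \<open>v\<close> through \<open>y\<close> is a lift by uniqueness. The
  free choice of \<open>y\<close> matters: two paths can be lifted from nearly closest
  representatives of their starting points.\<close>

lemma torus_lift_exists:
  fixes f :: "real \<Rightarrow> 'n::finite torus"
  assumes f: "\<And>s. s \<in> {a..b} \<Longrightarrow> has_torus_derivative f (\<lambda>h. h *\<^sub>R v s) s {a..b}"
    and v: "continuous_on {a..b} v" and ab: "a \<le> b" and "f a = torus_of y"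
  obtains F where "F a = y" "\<And>s. s \<in> {a..b} \<Longrightarrow> f s = torus_of (F s)"
    "\<And>s. s \<in> {a..b} \<Longrightarrow> (F has_vector_derivative v s) (at s within {a..b})"
proof -
  let ?F = "\<lambda>s. y + integral {a..s} v"
  have F: "(?F has_vector_derivative v s) (at s within {a..b})" if "s \<in> {a..b}" for s
    using has_vector_derivative_add[OF has_vector_derivative_const
        integral_has_vector_derivative[OF v that], of y] by simp
  have "f s = torus_of (?F s)" if "s \<in> {a..b}" for s
    by (rule torus_lift_unique[where S="{a..b}" and v=v and t\<^sub>0=a, OF _ _ that f F]) (use ab assms(4) in auto)
  with F show thesis by (intro that[of ?F]) auto
qed

section \<open>Comparison estimates for differential equations\<close>

lemma has_real_derivative_nonneg_imp_le:
  fixes f :: "real \<Rightarrow> real"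
  assumes "a \<le> b"
    and f: "\<And>s. s \<in> {a..b} \<Longrightarrow> (f has_real_derivative f' s) (at s within {a..b})"
    and f': "\<And>s. s \<in> {a..b} \<Longrightarrow> 0 \<le> f' s"
  shows "f a \<le> f b"
proof (cases "a = b")
  case False
  show ?thesis
  proof (rule DERIV_nonneg_imp_increasing_open[of a b f])
    show "continuous_on {a..b} f"
      using f DERIV_continuous_on by blast
    show "\<exists>y. (f has_real_derivative y) (at x) \<and> 0 \<le> y" if "a < x" "x < b" for x
      using f[of x] f'[of x] that at_within_Icc_at[of a x b] by auto
  qed (use assms in auto)
qed simp

text \<open>Squaring keeps the norm differentiable at zeros of \<open>u\<close>, and the weight
  \<open>exp (- 2 * K * s)\<close> makes the square nonincreasing. The minus sign in
  \<open>?w\<close> turns this into a monotone increase.\<close>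

lemma gronwall_norm:
  fixes u :: "real \<Rightarrow> 'a::real_inner"
  assumes ab: "a \<le> b"
    and u: "\<And>s. s \<in> {a..b} \<Longrightarrow> (u has_vector_derivative u' s) (at s within {a..b})"
    and u': "\<And>s. s \<in> {a..b} \<Longrightarrow> norm (u' s) \<le> K * norm (u s)"
  shows "norm (u b) \<le> exp (K * (b - a)) * norm (u a)"
proof -
  let ?w = "\<lambda>s. - (u s \<bullet> u s) * exp (- 2 * K * s)"
  let ?w' = "\<lambda>s. (2 * K * (u s \<bullet> u s) - 2 * (u s \<bullet> u' s)) * exp (- 2 * K * s)"
  have "?w a \<le> ?w b"
  proof (rule has_real_derivative_nonneg_imp_le[OF ab])
    fix s assume s: "s \<in> {a..b}"
    have "((\<lambda>s. u s \<bullet> u s) has_derivative (\<lambda>h. u s \<bullet> (h *\<^sub>R u' s) + (h *\<^sub>R u' s) \<bullet> u s)) (at s within {a..b})"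
      using u[OF s] unfolding has_vector_derivative_def
      by (rule has_derivative_inner) (use u[OF s] in \<open>simp add: has_vector_derivative_def\<close>)
    also have "(\<lambda>h. u s \<bullet> (h *\<^sub>R u' s) + (h *\<^sub>R u' s) \<bullet> u s) = (*) (2 * (u s \<bullet> u' s))"
      by (auto simp: inner_commute algebra_simps)
    finally have "((\<lambda>s. u s \<bullet> u s) has_real_derivative 2 * (u s \<bullet> u' s)) (at s within {a..b})"
      by (simp add: has_field_derivative_def)
    then show "(?w has_real_derivative ?w' s) (at s within {a..b})"
      by (auto intro!: derivative_eq_intros simp: algebra_simps)
    have "u s \<bullet> u' s \<le> norm (u s) * norm (u' s)"
      by (rule norm_cauchy_schwarz)
    also have "\<dots> \<le> norm (u s) * (K * norm (u s))"
      by (intro mult_left_mono u'[OF s] norm_ge_zero)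
    also have "\<dots> = K * (u s \<bullet> u s)"
      by (simp add: dot_square_norm power2_eq_square)
    finally show "0 \<le> ?w' s"
      by (intro mult_nonneg_nonneg) auto
  qed
  then have "(norm (u b))\<^sup>2 * exp (- 2 * K * b) \<le> (norm (u a))\<^sup>2 * exp (- 2 * K * a)"
    by (simp add: power2_norm_eq_inner)
  then have "(norm (u b))\<^sup>2 * exp (- 2 * K * b) * exp (2 * K * b)
      \<le> (norm (u a))\<^sup>2 * exp (- 2 * K * a) * exp (2 * K * b)"
    by (rule mult_right_mono) simp
  moreover have "exp (- 2 * K * b) * exp (2 * K * b) = 1"
    "exp (- 2 * K * a) * exp (2 * K * b) = (exp (K * (b - a)))\<^sup>2"
    unfolding exp_add[symmetric] exp_double[symmetric] by (simp_all add: algebra_simps)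
  ultimately have "(norm (u b))\<^sup>2 \<le> (exp (K * (b - a)) * norm (u a))\<^sup>2"
    by (simp only: mult.assoc power_mult_distrib mult_1_right) (simp add: mult.commute)
  then show ?thesis
    by (rule power2_le_imp_le) simp
qed

text \<open>The value \<open>\<rho> / l\<close> is the equilibrium under the largest forcing. The
  gap to it, multiplied by the integrating factor \<open>exp (l * s)\<close>, has derivative
  \<open>exp (l * s) * (\<rho> - r s)\<close>, which is nonnegative.\<close>

lemma linear_relaxation_upper_bound:
  fixes y :: "real \<Rightarrow> real"
  assumes ab: "a \<le> b" and l: "l > 0"
    and y: "\<And>s. s \<in> {a..b} \<Longrightarrow> (y has_real_derivative (r s - l * y s)) (at s within {a..b})"
    and r: "\<And>s. s \<in> {a..b} \<Longrightarrow> \<bar>r s\<bar> \<le> \<rho>"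
  shows "y b \<le> exp (- l * (b - a)) * \<bar>y a\<bar> + \<rho> / l"
proof -
  let ?w = "\<lambda>s. exp (l * s) * (\<rho> / l - y s)"
  have "?w a \<le> ?w b"
  proof (rule has_real_derivative_nonneg_imp_le[OF ab])
    fix s assume s: "s \<in> {a..b}"
    show "(?w has_real_derivative exp (l * s) * (\<rho> - r s)) (at s within {a..b})"
      using l by (auto intro!: derivative_eq_intros y[OF s] simp: algebra_simps)
    show "0 \<le> exp (l * s) * (\<rho> - r s)"
      using r[OF s] by (intro mult_nonneg_nonneg) auto
  qed
  then have "exp (- l * b) * ?w a \<le> exp (- l * b) * ?w b"
    by (rule mult_left_mono) simp
  moreover have "exp (- l * b) * exp (l * b) = 1" "exp (- l * b) * exp (l * a) = exp (- l * (b - a))"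
    unfolding mult_exp_exp by (simp_all add: right_diff_distrib)
  ultimately have "exp (- l * (b - a)) * (\<rho> / l - y a) \<le> \<rho> / l - y b"
    by (simp only: mult.assoc[symmetric] mult_1_left)
  moreover have "exp (- l * (b - a)) * (- \<bar>y a\<bar>) \<le> exp (- l * (b - a)) * (\<rho> / l - y a)"
  proof (rule mult_left_mono)
    have "0 \<le> \<rho> / l" using l r[of a] ab by simp
    then show "- \<bar>y a\<bar> \<le> \<rho> / l - y a" by linarith
  qed simp
  ultimately show ?thesis by simp
qed

lemma linear_relaxation_bound:
  fixes y :: "real \<Rightarrow> real"
  assumes ab: "a \<le> b" and l: "l > 0"
    and y: "\<And>s. s \<in> {a..b} \<Longrightarrow> (y has_real_derivative (r s - l * y s)) (at s within {a..b})"
    and r: "\<And>s. s \<in> {a..b} \<Longrightarrow> \<bar>r s\<bar> \<le> \<rho>"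
  shows "\<bar>y b\<bar> \<le> exp (- l * (b - a)) * \<bar>y a\<bar> + \<rho> / l"
proof -
  have "((\<lambda>s. - y s) has_real_derivative (- r s - l * (- y s))) (at s within {a..b})" if "s \<in> {a..b}" for s
    using y[OF that] by (auto intro!: derivative_eq_intros)
  then have "- y b \<le> exp (- l * (b - a)) * \<bar>- y a\<bar> + \<rho> / l"
    by (rule linear_relaxation_upper_bound[OF ab l]) (use r in auto)
  then show ?thesis
    using linear_relaxation_upper_bound[OF ab l y r] by auto
qed

section \<open>Flows of Lipschitz vector fields on the torus\<close>

lemma C_k_imp_continuous: "C_k k f \<Longrightarrow> continuous_on UNIV f"
  by (cases k) (auto intro!: differentiable_imp_continuous_on simp: differentiable_on_def)

text \<open>The derivative is periodic, so compactness of the unit cube bounds it globally.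
  \<open>C_k\<close> gives continuity only for each fixed direction; hence the operator norm is
  bounded by summing over basis directions.\<close>

lemma torus_C_k_Suc_lipschitz:
  fixes \<sigma> :: "'n::finite torus \<Rightarrow> 'b::real_normed_vector"
  assumes "C_k (Suc k) (\<lambda>y. \<sigma> (torus_of y))"
  obtains L where "0 \<le> L" "\<And>x y. norm (\<sigma> x - \<sigma> y) \<le> L * dist x y"
proof -
  define s where "s y = \<sigma> (torus_of y)" for y
  define s' where "s' x = frechet_derivative s (at x)" for x
  have s': "(s has_derivative s' x) (at x)" for x
    using assms unfolding s_def s'_def by (simp add: frechet_derivative_works)
  have per: "s' x = s' y" if eq: "torus_of x = torus_of y" for x y
  proof -
    have "s (z + (x - y)) = s z" for z
      unfolding s_def using torus_of_add_eq[OF eq] by simp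
    moreover have "((\<lambda>z. s (z + (x - y))) has_derivative s' x) (at y)"
      by (rule has_derivative_eq_rhs[OF has_derivative_compose[OF _ s', of _ "\<lambda>h. h"]])
        (auto intro!: derivative_eq_intros)
    ultimately have "(s has_derivative s' x) (at y)" by simp
    then show ?thesis using s' has_derivative_unique by blast
  qed
  have "\<exists>B. \<forall>x. norm (s' x v) \<le> B" for v
  proof -
    have "continuous_on UNIV (\<lambda>x. s' x v)"
      using assms C_k_imp_continuous unfolding s_def s'_def by auto
    then have "compact ((\<lambda>x. s' x v) ` cbox 0 1)"
      by (intro compact_continuous_image compact_cbox) (auto intro: continuous_on_subset)
    then have "bounded ((\<lambda>x. s' x v) ` cbox 0 1)" by (rule compact_imp_bounded)
    then obtain B where B: "\<And>x. x \<in> cbox 0 1 \<Longrightarrow> norm (s' x v) \<le> B"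
      unfolding bounded_iff by auto
    have "norm (s' x v) \<le> B" for x
    proof -
      obtain y where "y \<in> cbox 0 1" "torus_of y = torus_of x"
        by (rule torus_of_representative)
      then show ?thesis using B[of y] per[of y x] by simp
    qed
    then show ?thesis by (intro exI allI)
  qed
  then obtain B where B: "\<And>x v. norm (s' x v) \<le> B v" by metis
  define L where "L = (\<Sum>b\<in>Basis. B b)"
  have B0: "0 \<le> B v" for v using B[of 0 v] norm_ge_zero order_trans by blast
  have "onorm (s' x) \<le> L" for x
  proof (rule onorm_le)
    fix h
    interpret bounded_linear "s' x" by (rule has_derivative_bounded_linear[OF s'])
    have "s' x h = s' x (\<Sum>b\<in>Basis. (h \<bullet> b) *\<^sub>R b)" by (simp only: euclidean_representation)
    also have "\<dots> = (\<Sum>b\<in>Basis. (h \<bullet> b) *\<^sub>R s' x b)" by (simp add: sum scaleR)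
    also have "norm \<dots> \<le> (\<Sum>b\<in>Basis. B b * norm h)"
    proof (rule sum_norm_le)
      fix b :: "real ^ 'n" assume "b \<in> Basis"
      then have "\<bar>h \<bullet> b\<bar> * norm (s' x b) \<le> norm h * B b"
        using Basis_le_norm B B0 by (intro mult_mono) auto
      then show "norm ((h \<bullet> b) *\<^sub>R s' x b) \<le> B b * norm h" by (simp add: mult.commute)
    qed
    finally show "norm (s' x h) \<le> L * norm h" by (simp add: L_def sum_distrib_right)
  qed
  then have lip: "norm (s x - s y) \<le> L * norm (x - y)" for x y
    using s' by (intro differentiable_bound[of UNIV s s']) auto
  have L0: "0 \<le> L" unfolding L_def by (intro sum_nonneg B0)
  have "norm (\<sigma> a - \<sigma> b) \<le> L * dist a b" for a b
  proof (rule field_le_epsilon)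
    fix e :: real assume e: "e > 0"
    \<comment> \<open>Dividing by \<open>L + 1\<close> also covers \<open>L = 0\<close>.\<close>
    then have "dist a b < dist a b + e / (L + 1)" using L0 by simp
    then obtain x y where xy: "torus_of x = a" "torus_of y = b" "norm (x - y) < dist a b + e / (L + 1)"
      by (rule dist_torus_lessE)
    have "norm (\<sigma> a - \<sigma> b) \<le> L * norm (x - y)"
      using lip[of x y] xy by (simp add: s_def)
    also have "\<dots> \<le> L * (dist a b + e / (L + 1))"
      using xy L0 by (intro mult_left_mono) auto
    also have "\<dots> \<le> L * dist a b + e"
      using L0 e by (simp add: field_simps)
    finally show "norm (\<sigma> a - \<sigma> b) \<le> L * dist a b + e" .
  qed
  with L0 show thesis by (rule that)
qed

text \<open>\<open>torus_flow\<close> provides only a solution through each point; uniqueness, the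
  group law and continuity of \<phi> are derived here from the Lipschitz constant.\<close>

locale lipschitz_torus_flow =
  fixes \<sigma> :: "'n::finite torus \<Rightarrow> real ^ 'n" and \<phi> :: "real \<Rightarrow> 'n torus \<Rightarrow> 'n torus" and L :: real
  assumes L_nonneg: "0 \<le> L"
    and lipschitz: "norm (\<sigma> x - \<sigma> y) \<le> L * dist x y"
    and flow: "torus_flow \<sigma> \<phi>"
begin

lemma continuous_on_vector_field: "continuous_on S \<sigma>"
proof (rule continuous_onI)
  fix x e assume "x \<in> S" and e: "(e::real) > 0"
  have "dist (\<sigma> y) (\<sigma> x) \<le> e" if "dist y x < e / (L + 1)" for y
  proof -
    have "dist (\<sigma> y) (\<sigma> x) \<le> L * (e / (L + 1))"
      using lipschitz[of y x] that L_nonneg mult_left_mono[of "dist y x" "e / (L + 1)" L]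
      by (simp add: dist_norm)
    also have "\<dots> \<le> e" using L_nonneg e by (simp add: field_simps)
    finally show ?thesis .
  qed
  moreover have "e / (L + 1) > 0" using L_nonneg e by simp
  ultimately show "\<exists>d>0. \<forall>y\<in>S. dist y x < d \<longrightarrow> dist (\<sigma> y) (\<sigma> x) \<le> e" by blast
qed

text \<open>Lift both paths from nearly closest starting points and apply Gronwall to the
  difference. Equal starting points give uniqueness; the scalar speed \<open>a\<close> covers the
  flow, its reparametrisations and the multiscale position equation at once.\<close>

lemma path_stability:
  assumes c: "0 \<le> c"
    and f: "\<And>s. s \<in> {0..c} \<Longrightarrow> has_torus_derivative f (\<lambda>h. h *\<^sub>R (a s *\<^sub>R \<sigma> (f s))) s {0..c}"
    and g: "\<And>s. s \<in> {0..c} \<Longrightarrow> has_torus_derivative g (\<lambda>h. h *\<^sub>R (a s *\<^sub>R \<sigma> (g s))) s {0..c}"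
    and a: "continuous_on {0..c} a" "\<And>s. s \<in> {0..c} \<Longrightarrow> \<bar>a s\<bar> \<le> K"
  shows "dist (f c) (g c) \<le> exp (L * K * c) * dist (f 0) (g 0)"
proof -
  have K: "0 \<le> K" using a(2)[of 0] c by auto
  have v: "continuous_on {0..c} (\<lambda>s. a s *\<^sub>R \<sigma> (f s))"
    if "\<And>s. s \<in> {0..c} \<Longrightarrow> has_torus_derivative f (\<lambda>h. h *\<^sub>R (a s *\<^sub>R \<sigma> (f s))) s {0..c}" for f
  proof -
    have "continuous_on {0..c} f"
      unfolding continuous_on_def using that has_torus_derivative_continuous by blast
    then show ?thesis
      by (intro continuous_intros a continuous_on_compose2[OF continuous_on_vector_field[of UNIV]]) auto
  qed
  have "dist (f c) (g c) \<le> exp (L * K * c) * (dist (f 0) (g 0) + e)" if e: "e > 0" for e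
  proof -
    from e have "dist (f 0) (g 0) < dist (f 0) (g 0) + e" by simp
    then obtain x y where xy: "torus_of x = f 0" "torus_of y = g 0" "norm (x - y) < dist (f 0) (g 0) + e"
      by (rule dist_torus_lessE)
    obtain F where F: "F 0 = x" "\<And>s. s \<in> {0..c} \<Longrightarrow> f s = torus_of (F s)"
      "\<And>s. s \<in> {0..c} \<Longrightarrow> (F has_vector_derivative (a s *\<^sub>R \<sigma> (f s))) (at s within {0..c})"
      using torus_lift_exists[OF f v[OF f] c xy(1)[symmetric]] by blast
    obtain G where G: "G 0 = y" "\<And>s. s \<in> {0..c} \<Longrightarrow> g s = torus_of (G s)"
      "\<And>s. s \<in> {0..c} \<Longrightarrow> (G has_vector_derivative (a s *\<^sub>R \<sigma> (g s))) (at s within {0..c})"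
      using torus_lift_exists[OF g v[OF g] c xy(2)[symmetric]] by blast
    have "norm (F c - G c) \<le> exp (L * K * (c - 0)) * norm (F 0 - G 0)"
    proof (rule gronwall_norm[OF c])
      fix s assume s: "s \<in> {0..c}"
      show "((\<lambda>s. F s - G s) has_vector_derivative (a s *\<^sub>R \<sigma> (f s) - a s *\<^sub>R \<sigma> (g s))) (at s within {0..c})"
        by (intro has_vector_derivative_diff F(3) G(3) s)
      have "norm (a s *\<^sub>R \<sigma> (f s) - a s *\<^sub>R \<sigma> (g s)) = \<bar>a s\<bar> * norm (\<sigma> (f s) - \<sigma> (g s))"
        by (simp add: scaleR_diff_right[symmetric])
      also have "\<dots> \<le> K * (L * norm (F s - G s))"
        using dist_torus_of_le[of "F s" "G s"] L_nonneg K
        by (intro mult_mono a(2) s order_trans[OF lipschitz] mult_left_mono) (auto simp: F(2)[OF s] G(2)[OF s])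
      finally show "norm (a s *\<^sub>R \<sigma> (f s) - a s *\<^sub>R \<sigma> (g s)) \<le> L * K * norm (F s - G s)"
        by (simp add: mult_ac)
    qed
    moreover have "dist (f c) (g c) \<le> norm (F c - G c)"
      using F(2)[of c] G(2)[of c] c dist_torus_of_le by simp
    moreover have "exp (L * K * c) * norm (F 0 - G 0) \<le> exp (L * K * c) * (dist (f 0) (g 0) + e)"
      using xy(3) by (simp add: F(1) G(1))
    ultimately show ?thesis unfolding diff_0_right by linarith
  qed
  \<comment> \<open>Dividing by the exponential leaves the slack \<open>e\<close> without a factor,
    as \<open>field_le_epsilon\<close> requires.\<close>
  then have *: "dist (f c) (g c) / exp (L * K * c) \<le> dist (f 0) (g 0) + e" if "e > 0" for e
    using that by (simp add: divide_le_eq mult.commute)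
  have "dist (f c) (g c) / exp (L * K * c) \<le> dist (f 0) (g 0)"
    by (rule field_le_epsilon) (rule *)
  then show ?thesis by (simp add: divide_le_eq mult.commute)
qed

lemma flow_0 [simp]: "\<phi> 0 x = x"
  using flow by (simp add: torus_flow_def)

lemma flow_path:
  assumes "(A has_real_derivative a) (at s within S)"
  shows "has_torus_derivative (\<lambda>s. \<phi> (A s) x) (\<lambda>h. h *\<^sub>R (a *\<^sub>R \<sigma> (\<phi> (A s) x))) s S"
proof -
  have "has_torus_derivative (\<lambda>t. \<phi> t x) (\<lambda>h. h *\<^sub>R \<sigma> (\<phi> (A s) x)) (A s) UNIV"
    using flow by (simp add: torus_flow_def)
  from has_torus_derivative_compose[where A=A, OF this assms[unfolded has_field_derivative_def]]
  show ?thesis by (simp add: mult.commute)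
qed

text \<open>Running over \<open>{0..1}\<close> at constant speed \<open>t\<close> treats positive
  and negative times together.\<close>

lemma flow_lipschitz: "dist (\<phi> t x) (\<phi> t y) \<le> exp (L * \<bar>t\<bar>) * dist x y"
proof -
  have "has_torus_derivative (\<lambda>s. \<phi> (t * s) z) (\<lambda>h. h *\<^sub>R (t *\<^sub>R \<sigma> (\<phi> (t * s) z))) s {0..1}" for s z
    by (rule flow_path) (auto intro!: derivative_eq_intros)
  from path_stability[where c=1 and K="\<bar>t\<bar>", OF _ this this] show ?thesis by simp
qed

text \<open>Both sides follow \<sigma> at speed \<open>a\<close> from the same point, so the
  stability bound is zero. The speed may change sign, which it does for the velocity
  process.\<close>

lemma flow_time_change:
  assumes T: "0 \<le> T" and a: "continuous_on {0..T} a"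
    and Y: "\<And>s. s \<in> {0..T} \<Longrightarrow> has_torus_derivative Y (\<lambda>h. h *\<^sub>R (a s *\<^sub>R \<sigma> (Y s))) s {0..T}"
  shows "Y T = \<phi> (integral {0..T} a) (Y 0)"
proof -
  have "compact (a ` {0..T})" by (intro compact_continuous_image a) auto
  then have "bounded (a ` {0..T})" by (rule compact_imp_bounded)
  then obtain K where K: "\<And>s. s \<in> {0..T} \<Longrightarrow> \<bar>a s\<bar> \<le> K"
    unfolding bounded_iff real_norm_def by (metis imageI)
  have "has_torus_derivative (\<lambda>s. \<phi> (integral {0..s} a) (Y 0))
      (\<lambda>h. h *\<^sub>R (a s *\<^sub>R \<sigma> (\<phi> (integral {0..s} a) (Y 0)))) s {0..T}" if "s \<in> {0..T}" for s
    using integral_has_vector_derivative[OF a that]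
    by (intro flow_path) (simp add: has_real_derivative_iff_has_vector_derivative)
  from path_stability[OF T Y this a K] show ?thesis by simp
qed

text \<open>The path \<open>\<phi> (s * r + t) x\<close>, for \<open>r\<close> from 0 to 1, has
  constant speed \<open>s\<close> and starts at \<open>\<phi> t x\<close>; the time change
  identifies its end.\<close>

lemma flow_add: "\<phi> s (\<phi> t x) = \<phi> (s + t) x"
proof -
  have "has_torus_derivative (\<lambda>r. \<phi> (s * r + t) x) (\<lambda>h. h *\<^sub>R (s *\<^sub>R \<sigma> (\<phi> (s * r + t) x))) r {0..1}" for r
    by (rule flow_path) (auto intro!: derivative_eq_intros)
  from flow_time_change[where T=1, OF _ _ this] show ?thesis by simp
qed

lemma tendsto_flow:
  assumes t: "(t \<longlongrightarrow> t\<^sub>0) G" and x: "(x \<longlongrightarrow> x\<^sub>0) G"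
  shows "((\<lambda>n. \<phi> (t n) (x n)) \<longlongrightarrow> \<phi> t\<^sub>0 x\<^sub>0) G"
proof -
  have "has_torus_derivative (\<lambda>s. \<phi> s x\<^sub>0) (\<lambda>h. h *\<^sub>R \<sigma> (\<phi> s x\<^sub>0)) s UNIV" for s
    using flow by (simp add: torus_flow_def)
  then have "continuous_on UNIV (\<lambda>s. \<phi> s x\<^sub>0)"
    unfolding continuous_on_def using has_torus_derivative_continuous by blast
  from continuous_on_tendsto_compose[OF this t]
  have "((\<lambda>n. dist (\<phi> (t n) x\<^sub>0) (\<phi> t\<^sub>0 x\<^sub>0)) \<longlongrightarrow> 0) G"
    by (simp add: tendsto_dist_iff[symmetric])
  moreover have "((\<lambda>n. exp (L * \<bar>t n\<bar>) * dist (x n) x\<^sub>0) \<longlongrightarrow> exp (L * \<bar>t\<^sub>0\<bar>) * 0) G"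
    using x by (intro tendsto_intros t) (simp add: tendsto_dist_iff[symmetric])
  ultimately have lim: "((\<lambda>n. exp (L * \<bar>t n\<bar>) * dist (x n) x\<^sub>0 + dist (\<phi> (t n) x\<^sub>0) (\<phi> t\<^sub>0 x\<^sub>0)) \<longlongrightarrow> 0) G"
    using tendsto_add by fastforce
  have "dist (\<phi> (t n) (x n)) (\<phi> t\<^sub>0 x\<^sub>0)
      \<le> exp (L * \<bar>t n\<bar>) * dist (x n) x\<^sub>0 + dist (\<phi> (t n) x\<^sub>0) (\<phi> t\<^sub>0 x\<^sub>0)" for n
    using dist_triangle[of "\<phi> (t n) (x n)" "\<phi> t\<^sub>0 x\<^sub>0" "\<phi> (t n) x\<^sub>0"] flow_lipschitz[of "t n" "x n" x\<^sub>0] by simp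
  then have "((\<lambda>n. dist (\<phi> (t n) (x n)) (\<phi> t\<^sub>0 x\<^sub>0)) \<longlongrightarrow> 0) G"
    by (intro tendsto_sandwich[OF _ _ tendsto_const lim]) auto
  then show ?thesis by (rule tendsto_dist_iff[THEN iffD2])
qed

text \<open>Transporting the numerical path with the exact flow to the final time \<open>r\<close> makes the local
  errors telescope; the stability constant then involves only the partial sums of the time steps,
  not the sum of their absolute values (which diverges for Brownian increments).\<close>

lemma one_step_method_telescope:
  assumes local_error: "\<And>t x. dist (\<Phi> t x) (\<phi> t x) \<le> C * \<bar>t\<bar> ^ 3 * exp (C * \<bar>t\<bar>)"
    and Y: "\<And>n. Y (Suc n) = \<Phi> (\<tau> n) (Y n)"
  shows "dist (\<phi> (r - (\<Sum>k<n. \<tau> k)) (Y n)) (\<phi> r (Y 0))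
    \<le> (\<Sum>k<n. exp (L * \<bar>r - (\<Sum>j<Suc k. \<tau> j)\<bar>) * (C * \<bar>\<tau> k\<bar> ^ 3 * exp (C * \<bar>\<tau> k\<bar>)))"
proof (induction n)
  case (Suc n)
  let ?q = "r - (\<Sum>j<Suc n. \<tau> j)"
  have "\<phi> (r - (\<Sum>k<n. \<tau> k)) (Y n) = \<phi> ?q (\<phi> (\<tau> n) (Y n))"
    by (simp add: flow_add)
  then have "dist (\<phi> ?q (Y (Suc n))) (\<phi> (r - (\<Sum>k<n. \<tau> k)) (Y n)) \<le> exp (L * \<bar>?q\<bar>) * dist (\<Phi> (\<tau> n) (Y n)) (\<phi> (\<tau> n) (Y n))"
    using flow_lipschitz by (simp add: Y)
  also have "\<dots> \<le> exp (L * \<bar>?q\<bar>) * (C * \<bar>\<tau> n\<bar> ^ 3 * exp (C * \<bar>\<tau> n\<bar>))"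
    by (intro mult_left_mono local_error) simp
  finally show ?case
    using Suc.IH dist_triangle[of "\<phi> ?q (Y (Suc n))" "\<phi> r (Y 0)" "\<phi> (r - (\<Sum>k<n. \<tau> k)) (Y n)"] by simp
qed simp

text \<open>The remaining time \<open>r - \<dots>\<close> and each single step are differences of
  two partial sums, hence at most \<open>2 * B\<close>. Both exponentials thus leave the sum as a
  factor independent of the number of steps.\<close>

lemma one_step_method_error:
  assumes C: "C > 0" and local_error: "\<And>t x. dist (\<Phi> t x) (\<phi> t x) \<le> C * \<bar>t\<bar> ^ 3 * exp (C * \<bar>t\<bar>)"
    and Y: "\<And>n. Y (Suc n) = \<Phi> (\<tau> n) (Y n)"
    and B: "\<And>n. n \<le> N \<Longrightarrow> \<bar>\<Sum>k<n. \<tau> k\<bar> \<le> B"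
  shows "dist (Y N) (\<phi> (\<Sum>k<N. \<tau> k) (Y 0)) \<le> C * exp (2 * (L + C) * B) * (\<Sum>k<N. \<bar>\<tau> k\<bar> ^ 3)"
proof -
  let ?r = "\<Sum>k<N. \<tau> k"
  have "dist (Y N) (\<phi> ?r (Y 0))
      \<le> (\<Sum>k<N. exp (L * \<bar>?r - (\<Sum>j<Suc k. \<tau> j)\<bar>) * (C * \<bar>\<tau> k\<bar> ^ 3 * exp (C * \<bar>\<tau> k\<bar>)))"
    using one_step_method_telescope[where \<Phi>=\<Phi> and Y=Y and \<tau>=\<tau>, OF local_error Y, of ?r N] by simp
  also have "\<dots> \<le> (\<Sum>k<N. exp (L * (2 * B)) * (C * \<bar>\<tau> k\<bar> ^ 3 * exp (C * (2 * B))))"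
  proof (rule sum_mono)
    fix k assume k: "k \<in> {..<N}"
    have "\<bar>?r - (\<Sum>j<Suc k. \<tau> j)\<bar> \<le> 2 * B"
      using B[of N] B[of "Suc k"] k by simp
    moreover have "\<bar>\<tau> k\<bar> \<le> 2 * B"
      using B[of k] B[of "Suc k"] k by simp
    ultimately show "exp (L * \<bar>?r - (\<Sum>j<Suc k. \<tau> j)\<bar>) * (C * \<bar>\<tau> k\<bar> ^ 3 * exp (C * \<bar>\<tau> k\<bar>))
        \<le> exp (L * (2 * B)) * (C * \<bar>\<tau> k\<bar> ^ 3 * exp (C * (2 * B)))"
      using C L_nonneg by (intro mult_mono) (auto intro!: mult_left_mono)
  qed
  also have "\<dots> = C * exp (2 * (L + C) * B) * (\<Sum>k<N. \<bar>\<tau> k\<bar> ^ 3)"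
    unfolding sum_distrib_left by (rule sum.cong) (simp_all add: mult_exp_exp algebra_simps)
  finally show ?thesis .
qed

end

section \<open>The velocity equation along a fixed noise path\<close>

lemma velocity_integral:
  fixes \<epsilon> :: real
  assumes "\<epsilon> > 0" and "m T = m\<^sub>0 - integral {0..T} (\<lambda>s. m s / \<epsilon>\<^sup>2) + (w T - w 0) / \<epsilon>"
  shows "integral {0..T} (\<lambda>s. m s / \<epsilon>) = \<epsilon> * (m\<^sub>0 - m T) + (w T - w 0)"
proof -
  have "integral {0..T} (\<lambda>s. m s / \<epsilon>) = \<epsilon> * integral {0..T} (\<lambda>s. m s / \<epsilon>\<^sup>2)"
    using assms(1) by (simp add: power2_eq_square)
  also have "\<dots> = \<epsilon> * (m\<^sub>0 - m T + (w T - w 0) / \<epsilon>)"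
    using assms(2) by simp
  also have "\<dots> = \<epsilon> * (m\<^sub>0 - m T) + (w T - w 0)"
    using assms(1) by (simp add: distrib_left)
  finally show ?thesis .
qed

text \<open>The path is only continuous, so the estimate is made for an integrated velocity. Before
  \<open>T - \<delta>\<close> a crude bound by \<open>B\<close> suffices, since the last window of
  length \<delta> damps it by \<open>exp (- \<delta> / \<epsilon>\<^sup>2)\<close>; inside that
  window the forcing is as small as the oscillation \<eta> of the path.\<close>

lemma velocity_relaxation_bound:
  fixes \<epsilon> T \<delta> :: real and m w :: "real \<Rightarrow> real"
  assumes eps: "\<epsilon> > 0" and m: "continuous_on {0..} m"
    and m_eq: "\<And>t. 0 \<le> t \<Longrightarrow> m t = m\<^sub>0 - integral {0..t} (\<lambda>s. m s / \<epsilon>\<^sup>2) + (w t - w 0) / \<epsilon>"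
    and d: "0 < \<delta>" "\<delta> < T"
    and B: "\<And>s. s \<in> {0..T} \<Longrightarrow> \<bar>w s - w 0\<bar> \<le> B"
    and \<eta>: "\<And>s. s \<in> {T - \<delta>..T} \<Longrightarrow> \<bar>w s - w T\<bar> \<le> \<eta>"
  shows "\<bar>\<epsilon> * m T\<bar> \<le> \<epsilon>\<^sup>2 / \<delta> * (3 * B + \<bar>\<epsilon> * m\<^sub>0\<bar>) + 2 * \<bar>\<epsilon> * m\<^sub>0\<bar> + \<eta>"
proof -
  define l where "l = 1 / \<epsilon>\<^sup>2"
  have l: "l > 0" using eps by (simp add: l_def)
  \<comment> \<open>\<open>y\<close> solves \<open>y' = r - l * y\<close>, with the path in the
    forcing \<open>r\<close> and not differentiated. Centring at \<open>w T\<close> makes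
    \<open>r\<close> small near the final time.\<close>
  define y where "y t = \<epsilon> * integral {0..t} m - (w T - w 0) / l" for t
  define r where "r t = \<epsilon> * m\<^sub>0 + (w t - w T)" for t
  have "l * y t = r t - \<epsilon> * m t" if "0 \<le> t" for t
  proof -
    have "\<epsilon> * m t = \<epsilon> * m\<^sub>0 - l * (\<epsilon> * integral {0..t} m) + (w t - w 0)"
      using m_eq[OF that] eps by (simp add: l_def field_simps)
    moreover have "l * y t = l * (\<epsilon> * integral {0..t} m) - (w T - w 0)"
      using l by (simp add: y_def right_diff_distrib[of l "\<epsilon> * integral {0..t} m"])
    ultimately show ?thesis by (simp add: r_def)
  qed
  then have m_y: "\<epsilon> * m t = r t - l * y t" if "0 \<le> t" for t
    using that by simp
  have y: "(y has_real_derivative (r t - l * y t)) (at t within {a..b})"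
    if "0 \<le> a" "b \<le> T" "t \<in> {a..b}" for a b t
  proof -
    have "continuous_on {0..T} m" using m by (rule continuous_on_subset) auto
    then have "((\<lambda>t. integral {0..t} m) has_real_derivative m t) (at t within {0..T})"
      using integral_has_real_derivative[of 0 T m t] that by auto
    then have "(y has_real_derivative \<epsilon> * m t) (at t within {0..T})"
      unfolding y_def by (auto intro!: derivative_eq_intros)
    then show ?thesis
      using that DERIV_subset[of y _ t "{0..T}" "{a..b}"] m_y[of t] by auto
  qed
  have r: "\<bar>r s\<bar> \<le> \<bar>\<epsilon> * m\<^sub>0\<bar> + 2 * B" if "s \<in> {0..T}" for s
    using B[OF that] B[of T] d unfolding r_def by auto
  have r': "\<bar>r s\<bar> \<le> \<bar>\<epsilon> * m\<^sub>0\<bar> + \<eta>" if "s \<in> {T - \<delta>..T}" for s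
    using \<eta>[OF that] unfolding r_def by linarith
  have y0: "\<bar>y 0\<bar> \<le> B / l"
    using B[of T] d l by (simp add: y_def divide_right_mono)
  \<comment> \<open>The later factor \<open>3 * B\<close> is \<open>B\<close> from the initial value
    plus \<open>2 * B\<close> from the forcing.\<close>
  have "\<bar>y (T - \<delta>)\<bar> \<le> exp (- l * (T - \<delta> - 0)) * \<bar>y 0\<bar> + (\<bar>\<epsilon> * m\<^sub>0\<bar> + 2 * B) / l"
    by (rule linear_relaxation_bound[where r=r]) (use d l y r in auto)
  also have "exp (- l * (T - \<delta> - 0)) * \<bar>y 0\<bar> \<le> 1 * (B / l)"
    using l d y0 by (intro mult_mono) auto
  finally have yd: "\<bar>y (T - \<delta>)\<bar> \<le> (3 * B + \<bar>\<epsilon> * m\<^sub>0\<bar>) / l"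
    by (simp add: add_divide_distrib)
  have "\<bar>y T\<bar> \<le> exp (- l * (T - (T - \<delta>))) * \<bar>y (T - \<delta>)\<bar> + (\<bar>\<epsilon> * m\<^sub>0\<bar> + \<eta>) / l"
    by (rule linear_relaxation_bound[where r=r]) (use d l y r' in auto)
  also have "exp (- l * (T - (T - \<delta>))) * \<bar>y (T - \<delta>)\<bar> \<le> (\<epsilon>\<^sup>2 / \<delta>) * ((3 * B + \<bar>\<epsilon> * m\<^sub>0\<bar>) / l)"
  proof (rule mult_mono[OF _ yd])
    \<comment> \<open>From the exponential decay only the rate \<open>1 / (l * \<delta>)\<close>,
      which equals \<open>\<epsilon>\<^sup>2 / \<delta>\<close>, is kept.\<close>
    have "l * \<delta> \<le> exp (l * \<delta>)" using exp_ge_add_one_self[of "l * \<delta>"] by linarith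
    then show "exp (- l * (T - (T - \<delta>))) \<le> \<epsilon>\<^sup>2 / \<delta>"
      using eps d by (simp add: exp_minus l_def field_simps)
  qed (use d in auto)
  finally have "l * \<bar>y T\<bar> \<le> l * ((\<epsilon>\<^sup>2 / \<delta>) * ((3 * B + \<bar>\<epsilon> * m\<^sub>0\<bar>) / l) + (\<bar>\<epsilon> * m\<^sub>0\<bar> + \<eta>) / l)"
    using l by (intro mult_left_mono) auto
  also have "\<dots> = (\<epsilon>\<^sup>2 / \<delta>) * (3 * B + \<bar>\<epsilon> * m\<^sub>0\<bar>) + (\<bar>\<epsilon> * m\<^sub>0\<bar> + \<eta>)"
    using l by (subst distrib_left) simp
  finally have "\<bar>l * y T\<bar> \<le> (\<epsilon>\<^sup>2 / \<delta>) * (3 * B + \<bar>\<epsilon> * m\<^sub>0\<bar>) + (\<bar>\<epsilon> * m\<^sub>0\<bar> + \<eta>)"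
    using l by (simp add: abs_mult)
  moreover have "\<epsilon> * m T = \<epsilon> * m\<^sub>0 - l * y T"
    using m_y[of T] d by (simp add: r_def)
  ultimately show ?thesis by linarith
qed

text \<open>Continuity of \<open>w\<close> at \<open>T\<close> fixes \<delta> for the oscillation
  \<open>e / 2\<close> first; the other terms then vanish with \<epsilon>, although
  \<open>m k T\<close> itself need not converge.\<close>

lemma velocity_relaxation:
  fixes \<epsilon> :: "nat \<Rightarrow> real" and m :: "nat \<Rightarrow> real \<Rightarrow> real" and w :: "real \<Rightarrow> real" and T :: real
  assumes eps: "\<And>k. \<epsilon> k > 0" "\<epsilon> \<longlonglongrightarrow> 0" and T: "T > 0"
    and m: "\<And>k. continuous_on {0..} (m k)"
    and m_eq: "\<And>k t. 0 \<le> t \<Longrightarrow> m k t = m\<^sub>0 k - integral {0..t} (\<lambda>s. m k s / (\<epsilon> k)\<^sup>2) + (w t - w 0) / \<epsilon> k"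
    and m0: "(\<lambda>k. \<epsilon> k * m\<^sub>0 k) \<longlonglongrightarrow> 0" and w: "continuous_on {0..} w"
  shows "(\<lambda>k. \<epsilon> k * m k T) \<longlonglongrightarrow> 0"
proof (rule LIMSEQ_I)
  fix e :: real assume e: "e > 0"
  have wT: "continuous_on {0..T} w" using w by (rule continuous_on_subset) auto
  then have "bounded ((\<lambda>s. w s - w 0) ` {0..T})"
    by (intro compact_imp_bounded compact_continuous_image continuous_intros) auto
  then obtain B where B: "\<And>s. s \<in> {0..T} \<Longrightarrow> \<bar>w s - w 0\<bar> \<le> B"
    unfolding bounded_iff by (metis imageI real_norm_def)
  obtain d where d: "d > 0" "\<And>s. s \<in> {0..T} \<Longrightarrow> dist s T < d \<Longrightarrow> dist (w s) (w T) < e / 2"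
    using wT T e unfolding continuous_on_iff by (metis atLeastAtMost_iff half_gt_zero less_imp_le order_refl)
  define \<delta> where "\<delta> = min d T / 2"
  have \<delta>: "0 < \<delta>" "\<delta> < T" "\<delta> < d" using d T by (auto simp: \<delta>_def)
  have near: "\<bar>w s - w T\<bar> \<le> e / 2" if "s \<in> {T - \<delta>..T}" for s
    using d(2)[of s] that \<delta> by (auto simp: dist_real_def)
  let ?g = "\<lambda>k. (\<epsilon> k)\<^sup>2 / \<delta> * (3 * B + \<bar>\<epsilon> k * m\<^sub>0 k\<bar>) + 2 * \<bar>\<epsilon> k * m\<^sub>0 k\<bar>"
  have "?g \<longlonglongrightarrow> 0\<^sup>2 / \<delta> * (3 * B + \<bar>0\<bar>) + 2 * \<bar>0\<bar>"
    using \<delta> by (intro tendsto_intros eps m0) auto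
  then have "\<forall>\<^sub>F k in sequentially. ?g k < e / 2"
    using e by (intro order_tendstoD(2)[of ?g]) auto
  then have "\<forall>\<^sub>F k in sequentially. norm (\<epsilon> k * m k T - 0) < e"
  proof eventually_elim
    case (elim k)
    have "\<bar>\<epsilon> k * m k T\<bar> \<le> ?g k + e / 2"
      by (rule velocity_relaxation_bound[OF eps(1) m m_eq \<delta>(1,2) B near])
    then show ?case using elim unfolding real_norm_def diff_0_right by linarith
  qed
  then show "\<exists>no. \<forall>n\<ge>no. norm (\<epsilon> n * m n T - 0) < e"
    by (simp add: eventually_sequentially)
qed

text \<open>Three forms for three uses: the solved recursion for measurability and induction, the
  telescoping form for sums of steps, and a form of the step that has no singularity at \<epsilon> =
  0.\<close>

lemma implicit_euler_step:
  fixes \<epsilon> h :: real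
  assumes "\<epsilon> > 0" "h \<ge> 0" "m' = m - h / \<epsilon>\<^sup>2 * m' + d / \<epsilon>"
  shows "m' = (\<epsilon>\<^sup>2 * m + \<epsilon> * d) / (\<epsilon>\<^sup>2 + h)" "h * m' / \<epsilon> = \<epsilon> * (m - m') + d"
    "h * m' / \<epsilon> = h * (\<epsilon> * m + d) / (\<epsilon>\<^sup>2 + h)"
proof -
  have pos: "\<epsilon>\<^sup>2 + h > 0" using assms by (simp add: add_pos_nonneg)
  have "\<epsilon>\<^sup>2 * m' = \<epsilon>\<^sup>2 * (m - h / \<epsilon>\<^sup>2 * m' + d / \<epsilon>)" using assms(3) by simp
  also have "\<dots> = \<epsilon>\<^sup>2 * m - h * m' + \<epsilon> * d"
    using assms(1) by (simp add: field_simps power2_eq_square)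
  finally have eq: "\<epsilon>\<^sup>2 * m' = \<epsilon>\<^sup>2 * m - h * m' + \<epsilon> * d" .
  then show 1: "m' = (\<epsilon>\<^sup>2 * m + \<epsilon> * d) / (\<epsilon>\<^sup>2 + h)"
    using pos by (simp add: field_simps)
  show "h * m' / \<epsilon> = \<epsilon> * (m - m') + d"
    using eq assms(1) by (simp add: field_simps power2_eq_square)
  have "m' / \<epsilon> = (\<epsilon> * m + d) / (\<epsilon>\<^sup>2 + h)"
    unfolding 1 using assms(1) by (simp add: power2_eq_square mult.assoc flip: distrib_left)
  then show "h * m' / \<epsilon> = h * (\<epsilon> * m + d) / (\<epsilon>\<^sup>2 + h)"
    by (metis times_divide_eq_right)
qed

text \<open>The additive noise enters scheme and equation alike and cancels in the error. What
  remains is the quadrature error of the drift, governed by the oscillation of \<open>m\<close> over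
  one step; the scaling \<open>c * \<epsilon>\<^sup>2\<close> makes it \<open>c * h\<close> per
  step.\<close>

lemma implicit_euler_error:
  fixes \<epsilon> h T :: real and m w :: "real \<Rightarrow> real"
  assumes eps: "\<epsilon> > 0" and h: "h > 0" and N: "T = real N * h" and c: "c \<ge> 0"
    and m: "continuous_on {0..} m"
    and m_eq: "\<And>t. 0 \<le> t \<Longrightarrow> m t = m\<^sub>0 - integral {0..t} (\<lambda>s. m s / \<epsilon>\<^sup>2) + (w t - w 0) / \<epsilon>"
    and \<mu>0: "\<mu> 0 = m\<^sub>0"
    and \<mu>: "\<And>n. \<mu> (Suc n) = \<mu> n - h / \<epsilon>\<^sup>2 * \<mu> (Suc n) + (w (real (Suc n) * h) - w (real n * h)) / \<epsilon>"
    and osc: "\<And>s t. s \<in> {0..T} \<Longrightarrow> t \<in> {0..T} \<Longrightarrow> \<bar>s - t\<bar> \<le> h \<Longrightarrow> \<bar>m s - m t\<bar> \<le> c * \<epsilon>\<^sup>2"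
    and "n \<le> N"
  shows "\<bar>\<mu> n - m (real n * h)\<bar> \<le> real n * h * c"
  using \<open>n \<le> N\<close>
proof (induction n)
  case 0
  then show ?case using \<mu>0 m_eq[of 0] by simp
next
  case (Suc n)
  let ?a = "real n * h" and ?b = "real (Suc n) * h"
  have "?b \<le> T"
    unfolding N using h Suc.prems by (intro mult_right_mono) auto
  moreover have "?b = ?a + h"
    by (simp add: distrib_right)
  ultimately have ab: "0 \<le> ?a" "?a \<le> ?b" "?b - ?a = h" "?b \<le> T"
    using h by auto
  have cont: "continuous_on S m" if "S \<subseteq> {0..}" for S
    using m that by (rule continuous_on_subset)
  have sub: "{0..?b} \<subseteq> {0..}" "{?a..?b} \<subseteq> {0..}"
    by (auto simp del: of_nat_Suc intro: order_trans[OF ab(1)])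
  have int: "m integrable_on {0..?b}" "m integrable_on {?a..?b}"
    by (intro integrable_continuous_real cont sub)+
  have "integral {0..?a} m + integral {?a..?b} m = integral {0..?b} m"
    using ab int by (intro Henstock_Kurzweil_Integration.integral_combine) auto
  then have "integral {0..?b} m / \<epsilon>\<^sup>2 = integral {0..?a} m / \<epsilon>\<^sup>2 + integral {?a..?b} m / \<epsilon>\<^sup>2"
    by (metis add_divide_distrib)
  moreover have "m ?a = m\<^sub>0 - integral {0..?a} m / \<epsilon>\<^sup>2 + (w ?a - w 0) / \<epsilon>"
    "m ?b = m\<^sub>0 - integral {0..?b} m / \<epsilon>\<^sup>2 + (w ?b - w 0) / \<epsilon>"
    using m_eq[of ?a] m_eq[of ?b] ab by simp_all
  ultimately have "m ?b = m ?a - integral {?a..?b} m / \<epsilon>\<^sup>2 + (w ?b - w ?a) / \<epsilon>"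
    unfolding diff_divide_distrib by linarith
  moreover have "integral {?a..?b} (\<lambda>s. m s - m ?b) = integral {?a..?b} m - h * m ?b"
    using int ab by (subst integral_diff) auto
  then have "integral {?a..?b} m / \<epsilon>\<^sup>2 = integral {?a..?b} (\<lambda>s. m s - m ?b) / \<epsilon>\<^sup>2 + h / \<epsilon>\<^sup>2 * m ?b"
    by (simp add: diff_divide_distrib)
  ultimately have step: "\<mu> (Suc n) - m ?b + h / \<epsilon>\<^sup>2 * (\<mu> (Suc n) - m ?b)
      = \<mu> n - m ?a + integral {?a..?b} (\<lambda>s. m s - m ?b) / \<epsilon>\<^sup>2"
    using \<mu>[of n] unfolding right_diff_distrib by linarith
  have "norm (integral {?a..?b} (\<lambda>s. m s - m ?b)) \<le> c * \<epsilon>\<^sup>2 * (?b - ?a)"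
  proof (rule integral_bound[OF ab(2)])
    show "continuous_on {?a..?b} (\<lambda>s. m s - m ?b)"
      by (intro continuous_intros cont sub)
    fix s assume s: "s \<in> {?a..?b}"
    then have "s \<in> {0..T}" "?b \<in> {0..T}" "\<bar>s - ?b\<bar> \<le> h"
      unfolding atLeastAtMost_iff using ab by linarith+
    then show "norm (m s - m ?b) \<le> c * \<epsilon>\<^sup>2"
      using osc by simp
  qed
  then have bound: "\<bar>integral {?a..?b} (\<lambda>s. m s - m ?b) / \<epsilon>\<^sup>2\<bar> \<le> c * h"
    using eps ab by (simp add: abs_divide divide_le_eq mult_ac)
  \<comment> \<open>The implicit factor is at least 1, so the inherited error cannot grow and local
    errors merely add up, with no exponential constant.\<close>
  have "\<bar>\<mu> (Suc n) - m ?b\<bar> \<le> \<bar>\<mu> (Suc n) - m ?b\<bar> * (1 + h / \<epsilon>\<^sup>2)"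
    using h by (simp add: algebra_simps)
  also have "\<dots> = \<bar>\<mu> (Suc n) - m ?b + h / \<epsilon>\<^sup>2 * (\<mu> (Suc n) - m ?b)\<bar>"
  proof -
    have "\<mu> (Suc n) - m ?b + h / \<epsilon>\<^sup>2 * (\<mu> (Suc n) - m ?b) = (\<mu> (Suc n) - m ?b) * (1 + h / \<epsilon>\<^sup>2)"
      by (simp only: distrib_left mult_1_right mult.commute[of "h / \<epsilon>\<^sup>2"])
    moreover have "0 \<le> 1 + h / \<epsilon>\<^sup>2" using h by simp
    ultimately show ?thesis by (simp only: abs_mult abs_of_nonneg)
  qed
  also have "\<dots> \<le> real n * h * c + c * h"
    unfolding step using Suc bound by linarith
  finally show ?case by (simp add: algebra_simps)
qed

text \<open>Uniform continuity of \<open>m\<close> on \<open>{0..T}\<close> supplies the oscillation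
  bound; \<open>c = e / T\<close> makes the accumulated error at most \<open>e\<close>.\<close>

lemma implicit_euler_uniform_convergence:
  fixes \<epsilon> T :: real and m w :: "real \<Rightarrow> real"
  assumes eps: "\<epsilon> > 0" and T: "T > 0" and e: "e > 0"
    and m: "continuous_on {0..} m"
    and m_eq: "\<And>t. 0 \<le> t \<Longrightarrow> m t = m\<^sub>0 - integral {0..t} (\<lambda>s. m s / \<epsilon>\<^sup>2) + (w t - w 0) / \<epsilon>"
    and \<mu>0: "\<And>N. 1 \<le> N \<Longrightarrow> \<mu> N 0 = m\<^sub>0"
    and \<mu>: "\<And>N n. 1 \<le> N \<Longrightarrow> \<mu> N (Suc n) = \<mu> N n - T / real N / \<epsilon>\<^sup>2 * \<mu> N (Suc n)
        + (w (real (Suc n) * (T / real N)) - w (real n * (T / real N))) / \<epsilon>"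
  shows "\<forall>\<^sub>F N in sequentially. \<forall>n\<le>N. \<bar>\<mu> N n - m (real n * (T / real N))\<bar> \<le> e"
proof -
  have "uniformly_continuous_on {0..T} m"
    by (intro compact_uniformly_continuous continuous_on_subset[OF m]) auto
  moreover define c where "c = e / T"
  then have c: "c > 0" using e T by simp
  ultimately obtain d where d: "d > 0"
    "\<And>s t. s \<in> {0..T} \<Longrightarrow> t \<in> {0..T} \<Longrightarrow> dist t s < d \<Longrightarrow> dist (m t) (m s) < c * \<epsilon>\<^sup>2"
    unfolding uniformly_continuous_on_def using eps by (metis mult_pos_pos zero_less_power)
  have "(\<lambda>N. T / real N) \<longlonglongrightarrow> 0" by (rule lim_const_over_n)
  then have "\<forall>\<^sub>F N in sequentially. T / real N < d" using d(1) by (rule order_tendstoD)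
  then show ?thesis
    using eventually_ge_at_top[of 1]
  proof eventually_elim
    case (elim N)
    show ?case
    proof (intro allI impI)
      fix n assume n: "n \<le> N"
      have "\<bar>\<mu> N n - m (real n * (T / real N))\<bar> \<le> real n * (T / real N) * c"
      proof (rule implicit_euler_error[OF eps _ _ _ m m_eq _ _ _ n])
        show "\<bar>m s - m t\<bar> \<le> c * \<epsilon>\<^sup>2" if "s \<in> {0..T}" "t \<in> {0..T}" "\<bar>s - t\<bar> \<le> T / real N" for s t
          using d(2)[OF that(2,1)] that(3) elim by (auto simp: dist_real_def)
      qed (use elim T c \<mu>0 \<mu> in auto)
      also have "\<dots> \<le> real N * (T / real N) * c"
        using n T c by (intro mult_right_mono) auto
      also have "\<dots> = e" using elim T by (simp add: c_def)
      finally show "\<bar>\<mu> N n - m (real n * (T / real N))\<bar> \<le> e" .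
    qed
  qed
qed

text \<open>At fixed \<open>h\<close> the ratio \<open>h / ((\<epsilon> k)\<^sup>2 + h)\<close>
  tends to 1 and \<open>\<epsilon> k * \<mu> k n\<close> vanishes by induction on \<open>n\<close>.
  The implicit damping forgets the old velocity and passes on the whole increment.\<close>

lemma scheme_step_limit:
  fixes \<epsilon> :: "nat \<Rightarrow> real" and h :: real
  assumes eps: "\<And>k. \<epsilon> k > 0" "\<epsilon> \<longlonglongrightarrow> 0" and h: "h > 0"
    and m0: "(\<lambda>k. \<epsilon> k * \<mu> k 0) \<longlonglongrightarrow> 0"
    and \<mu>: "\<And>k n. \<mu> k (Suc n) = \<mu> k n - h / (\<epsilon> k)\<^sup>2 * \<mu> k (Suc n) + d n / \<epsilon> k"
  shows "(\<lambda>k. h * \<mu> k (Suc n) / \<epsilon> k) \<longlonglongrightarrow> d n"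
proof -
  note step = implicit_euler_step[OF eps(1) less_imp_le[OF h] \<mu>]
  have lim: "(\<lambda>k. h * (\<epsilon> k * \<mu> k n + d n) / ((\<epsilon> k)\<^sup>2 + h)) \<longlonglongrightarrow> d n"
    if "(\<lambda>k. \<epsilon> k * \<mu> k n) \<longlonglongrightarrow> 0" for n
  proof -
    have "(\<lambda>k. h * (\<epsilon> k * \<mu> k n + d n) / ((\<epsilon> k)\<^sup>2 + h)) \<longlonglongrightarrow> h * (0 + d n) / (0\<^sup>2 + h)"
      using h by (intro tendsto_intros eps that) auto
    then show ?thesis using h by simp
  qed
  have "(\<lambda>k. \<epsilon> k * \<mu> k n) \<longlonglongrightarrow> 0" for n
  proof (induction n)
    case (Suc n)
    have "(\<lambda>k. \<epsilon> k * (\<epsilon> k * \<mu> k n + d n) * \<epsilon> k / ((\<epsilon> k)\<^sup>2 + h)) \<longlonglongrightarrow> 0 * (0 + d n) * 0 / (0\<^sup>2 + h)"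
      using h by (intro tendsto_intros eps Suc) auto
    moreover have "\<epsilon> k * \<mu> k (Suc n) = \<epsilon> k * (\<epsilon> k * \<mu> k n + d n) * \<epsilon> k / ((\<epsilon> k)\<^sup>2 + h)" for k
      unfolding step(1)[of k n] by (simp add: field_simps power2_eq_square)
    ultimately show ?case by simp
  qed (rule m0)
  from lim[OF this] show ?thesis using step(3) by simp
qed

section \<open>Pathwise convergence\<close>

text \<open>Taking the steps as a sequence lets the scheme at positive \<epsilon> and its limit be
  one map evaluated at different \<open>\<tau>\<close>.\<close>

primrec one_step_method :: "(real \<Rightarrow> 'a \<Rightarrow> 'a) \<Rightarrow> 'a \<Rightarrow> (nat \<Rightarrow> real) \<Rightarrow> nat \<Rightarrow> 'a" where
  "one_step_method \<Phi> x \<tau> 0 = x"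
| "one_step_method \<Phi> x \<tau> (Suc n) = \<Phi> (\<tau> n) (one_step_method \<Phi> x \<tau> n)"

context lipschitz_torus_flow
begin

lemma position_eq_flow:
  assumes eps: "\<epsilon> > 0" and T: "0 \<le> T" and m: "continuous_on {0..} m"
    and "m T = m\<^sub>0 - integral {0..T} (\<lambda>s. m s / \<epsilon>\<^sup>2) + (w T - w 0) / \<epsilon>"
    and X: "\<And>t. 0 \<le> t \<Longrightarrow> has_torus_derivative X (\<lambda>h. h *\<^sub>R ((m t / \<epsilon>) *\<^sub>R \<sigma> (X t))) t {0..}"
  shows "X T = \<phi> (\<epsilon> * (m\<^sub>0 - m T) + (w T - w 0)) (X 0)"
proof -
  have "continuous_on {0..T} (\<lambda>s. m s / \<epsilon>)"
    using eps by (intro continuous_intros continuous_on_subset[OF m]) auto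
  moreover have "has_torus_derivative X (\<lambda>h. h *\<^sub>R ((m s / \<epsilon>) *\<^sub>R \<sigma> (X s))) s {0..T}" if "s \<in> {0..T}" for s
    using that by (intro has_torus_derivative_subset[OF X]) auto
  ultimately have "X T = \<phi> (integral {0..T} (\<lambda>s. m s / \<epsilon>)) (X 0)"
    by (rule flow_time_change[OF T])
  then show ?thesis
    using velocity_integral[where m=m and w=w, OF eps assms(4)] by simp
qed

text \<open>The steps sum to \<open>?S N\<close>, and each is at most \<open>B / real N\<close>, so
  the cubic sum is at most \<open>B ^ 3 / N^2\<close>. As \<open>B\<close> contains the factor
  1/\<epsilon>, this serves the limit at fixed \<epsilon>.\<close>

lemma scheme_tendsto_solution:
  assumes C: "C > 0" and local_error: "\<And>t x. dist (\<Phi> t x) (\<phi> t x) \<le> C * \<bar>t\<bar> ^ 3 * exp (C * \<bar>t\<bar>)"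
    and eps: "\<epsilon> > 0" and T: "T > 0"
    and m: "continuous_on {0..} m"
    and m_eq: "\<And>t. 0 \<le> t \<Longrightarrow> m t = m\<^sub>0 - integral {0..t} (\<lambda>s. m s / \<epsilon>\<^sup>2) + (w t - w 0) / \<epsilon>"
    and \<mu>0: "\<And>N. 1 \<le> N \<Longrightarrow> \<mu> N 0 = m\<^sub>0"
    and \<mu>: "\<And>N n. 1 \<le> N \<Longrightarrow> \<mu> N (Suc n) = \<mu> N n - T / real N / \<epsilon>\<^sup>2 * \<mu> N (Suc n)
        + (w (real (Suc n) * (T / real N)) - w (real n * (T / real N))) / \<epsilon>"
  shows "(\<lambda>N. one_step_method \<Phi> x (\<lambda>k. T / real N * \<mu> N (Suc k) / \<epsilon>) N)
    \<longlonglongrightarrow> \<phi> (\<epsilon> * (m\<^sub>0 - m T) + (w T - w 0)) x"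
proof -
  have conv: "\<forall>\<^sub>F N in sequentially. \<forall>n\<le>N. \<bar>\<mu> N n - m (real n * (T / real N))\<bar> \<le> e"
    if "e > 0" for e
    by (rule implicit_euler_uniform_convergence[OF eps T that m m_eq \<mu>0 \<mu>])
  let ?Y = "\<lambda>N. one_step_method \<Phi> x (\<lambda>k. T / real N * \<mu> N (Suc k) / \<epsilon>)"
  let ?S = "\<lambda>N. \<epsilon> * (m\<^sub>0 - \<mu> N N) + (w T - w 0)"
  have S: "(\<Sum>k<n. T / real N * \<mu> N (Suc k) / \<epsilon>) = \<epsilon> * (m\<^sub>0 - \<mu> N n) + (w (real n * (T / real N)) - w 0)"
    if N: "1 \<le> N" for n N
  proof (induction n)
    case (Suc n)
    have "T / real N * \<mu> N (Suc n) / \<epsilon> = \<epsilon> * (\<mu> N n - \<mu> N (Suc n))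
        + (w (real (Suc n) * (T / real N)) - w (real n * (T / real N)))"
      by (rule implicit_euler_step(2)[OF eps _ \<mu>[OF N]]) (use T in auto)
    then show ?case using Suc.IH by (simp add: algebra_simps)
  qed (use \<mu>0[OF N] in simp)
  have "bounded (m ` {0..T})"
    by (intro compact_imp_bounded compact_continuous_image continuous_on_subset[OF m]) auto
  then obtain K where K: "\<And>s. s \<in> {0..T} \<Longrightarrow> \<bar>m s\<bar> \<le> K"
    unfolding bounded_iff by (metis imageI real_norm_def)
  \<comment> \<open>The extra 1 in \<open>K + 1\<close> absorbs the error of the velocity scheme,
    which is eventually at most 1.\<close>
  define B where "B = T * (K + 1) / \<epsilon>"
  have K0: "0 \<le> K" using K[of 0] T by auto
  have err: "\<forall>\<^sub>F N in sequentially. dist (?Y N N) (\<phi> (?S N) x)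
      \<le> C * exp (2 * (L + C) * B) * (B ^ 3 * (1 / real N)\<^sup>2)"
    using conv[OF zero_less_one] eventually_ge_at_top[of 1]
  proof eventually_elim
    case (elim N)
    have step: "\<bar>T / real N * \<mu> N (Suc k) / \<epsilon>\<bar> \<le> B / real N" if "k < N" for k
    proof -
      have "real (Suc k) * (T / real N) \<le> real N * (T / real N)"
        using T that by (intro mult_right_mono) auto
      then have "real (Suc k) * (T / real N) \<in> {0..T}"
        using T elim by simp
      then have "\<bar>m (real (Suc k) * (T / real N))\<bar> \<le> K" by (rule K)
      moreover have "\<bar>\<mu> N (Suc k) - m (real (Suc k) * (T / real N))\<bar> \<le> 1"
        using elim(1)[rule_format, of "Suc k"] that by simp
      ultimately have "\<bar>\<mu> N (Suc k)\<bar> \<le> K + 1" by linarith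
      then have "T / real N * \<bar>\<mu> N (Suc k)\<bar> / \<epsilon> \<le> T / real N * (K + 1) / \<epsilon>"
        using T eps by (intro divide_right_mono mult_left_mono) auto
      then show ?thesis using T eps by (simp add: B_def abs_mult mult_ac)
    qed
    have B0: "0 \<le> B" using K0 T eps by (simp add: B_def)
    have "dist (?Y N N) (\<phi> (\<Sum>k<N. T / real N * \<mu> N (Suc k) / \<epsilon>) (?Y N 0))
        \<le> C * exp (2 * (L + C) * B) * (\<Sum>k<N. \<bar>T / real N * \<mu> N (Suc k) / \<epsilon>\<bar> ^ 3)"
    proof (rule one_step_method_error[OF C local_error])
      fix n assume n: "n \<le> N"
      have "\<bar>\<Sum>k<n. T / real N * \<mu> N (Suc k) / \<epsilon>\<bar> \<le> (\<Sum>k<n. B / real N)"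
        using n by (intro order_trans[OF sum_abs] sum_mono step) auto
      also have "\<dots> \<le> B" using n elim B0 by (simp add: divide_le_eq mult_left_mono mult.commute)
      finally show "\<bar>\<Sum>k<n. T / real N * \<mu> N (Suc k) / \<epsilon>\<bar> \<le> B" .
    qed simp
    also have "\<dots> \<le> C * exp (2 * (L + C) * B) * (\<Sum>k<N. (B / real N) ^ 3)"
      using C by (intro mult_left_mono sum_mono power_mono step) auto
    also have "(\<Sum>k<N. (B / real N) ^ 3) = B ^ 3 * (1 / real N)\<^sup>2"
      using elim by (simp add: power_divide power2_eq_square power3_eq_cube)
    finally show ?case using S[OF elim(2), of N] elim(2) by simp
  qed
  have "(\<lambda>N. C * exp (2 * (L + C) * B) * (B ^ 3 * (1 / real N)\<^sup>2)) \<longlonglongrightarrow> C * exp (2 * (L + C) * B) * (B ^ 3 * 0\<^sup>2)"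
    by (intro tendsto_intros lim_const_over_n)
  then have "(\<lambda>N. C * exp (2 * (L + C) * B) * (B ^ 3 * (1 / real N)\<^sup>2)) \<longlonglongrightarrow> 0" by simp
  then have dist0: "(\<lambda>N. dist (?Y N N) (\<phi> (?S N) x)) \<longlonglongrightarrow> 0"
    by (rule tendsto_sandwich[OF always_eventually err tendsto_const, rotated]) simp
  have "(\<lambda>N. \<mu> N N) \<longlonglongrightarrow> m T"
  proof (rule tendstoI)
    fix e :: real assume "e > 0"
    then have "e / 2 > 0" by simp
    from conv[OF this] eventually_ge_at_top[of 1]
    show "\<forall>\<^sub>F N in sequentially. dist (\<mu> N N) (m T) < e"
    proof eventually_elim
      case (elim N)
      from elim(1)[rule_format, of N] elim(2) \<open>e > 0\<close> show ?case by (simp add: dist_real_def)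
    qed
  qed
  then have "(\<lambda>N. \<phi> (?S N) x) \<longlonglongrightarrow> \<phi> (\<epsilon> * (m\<^sub>0 - m T) + (w T - w 0)) x"
    by (intro tendsto_flow tendsto_intros)
  then have "(\<lambda>N. dist (\<phi> (?S N) x) (\<phi> (\<epsilon> * (m\<^sub>0 - m T) + (w T - w 0)) x)) \<longlonglongrightarrow> 0"
    by (rule tendsto_dist_iff[THEN iffD1])
  from tendsto_add[OF dist0 this]
  have "(\<lambda>N. dist (?Y N N) (\<phi> (\<epsilon> * (m\<^sub>0 - m T) + (w T - w 0)) x)) \<longlonglongrightarrow> 0"
    unfolding add_0_left
    by (rule tendsto_sandwich[OF always_eventually always_eventually tendsto_const, rotated 2])
      (auto intro: dist_triangle)
  then show ?thesis by (rule tendsto_dist_iff[THEN iffD2])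
qed

lemma solution_tendsto_flow:
  assumes m: "(\<lambda>k. \<epsilon> k * m k) \<longlonglongrightarrow> 0" and m0: "(\<lambda>k. \<epsilon> k * m\<^sub>0 k) \<longlonglongrightarrow> 0" and x: "x \<longlonglongrightarrow> x\<^sub>0"
  shows "(\<lambda>k. \<phi> (\<epsilon> k * (m\<^sub>0 k - m k) + b) (x k)) \<longlonglongrightarrow> \<phi> b x\<^sub>0"
proof -
  have "(\<lambda>k. \<epsilon> k * m\<^sub>0 k - \<epsilon> k * m k + b) \<longlonglongrightarrow> 0 - 0 + b"
    by (intro tendsto_intros m m0)
  then show ?thesis by (intro tendsto_flow x) (simp add: right_diff_distrib)
qed

text \<open>Partial sums of the increments telescope to \<open>w\<close> minus its initial value and
  are bounded on \<open>{0..T}\<close>, even if the absolute increments have unbounded sums. The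
  index map \<open>r\<close> is there because cubic sums are controlled pathwise only along
  subsequences.\<close>

lemma limit_scheme_tendsto_flow:
  fixes r :: "nat \<Rightarrow> nat"
  assumes C: "C > 0" and local_error: "\<And>t x. dist (\<Phi> t x) (\<phi> t x) \<le> C * \<bar>t\<bar> ^ 3 * exp (C * \<bar>t\<bar>)"
    and T: "T > 0" and w: "continuous_on {0..} w" and r: "strict_mono r"
  defines "d \<equiv> \<lambda>N k. w (real (Suc k) * (T / real N)) - w (real k * (T / real N))"
  assumes cubic: "(\<lambda>i. \<Sum>k<r i. \<bar>d (r i) k\<bar> ^ 3) \<longlonglongrightarrow> 0"
  shows "(\<lambda>i. one_step_method \<Phi> x (d (r i)) (r i)) \<longlonglongrightarrow> \<phi> (w T - w 0) x"
proof -
  have "bounded ((\<lambda>s. w s - w 0) ` {0..T})"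
    by (intro compact_imp_bounded compact_continuous_image continuous_intros continuous_on_subset[OF w]) auto
  then obtain B where B: "\<And>s. s \<in> {0..T} \<Longrightarrow> \<bar>w s - w 0\<bar> \<le> B"
    unfolding bounded_iff by (metis imageI real_norm_def)
  have S: "(\<Sum>k<n. d N k) = w (real n * (T / real N)) - w 0" for n N
    unfolding d_def using sum_lessThan_telescope[of "\<lambda>k. w (real k * (T / real N))" n] by simp
  have "dist (one_step_method \<Phi> x (d N) N) (\<phi> (w T - w 0) x)
      \<le> C * exp (2 * (L + C) * B) * (\<Sum>k<N. \<bar>d N k\<bar> ^ 3)" if N: "1 \<le> N" for N
  proof -
    have "dist (one_step_method \<Phi> x (d N) N) (\<phi> (\<Sum>k<N. d N k) (one_step_method \<Phi> x (d N) 0))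
        \<le> C * exp (2 * (L + C) * B) * (\<Sum>k<N. \<bar>d N k\<bar> ^ 3)"
    proof (rule one_step_method_error[OF C local_error])
      fix n assume "n \<le> N"
      then have "real n * (T / real N) \<le> real N * (T / real N)"
        using T by (intro mult_right_mono) auto
      then show "\<bar>\<Sum>k<n. d N k\<bar> \<le> B"
        unfolding S using T N by (intro B) auto
    qed simp
    then show ?thesis unfolding S using N by simp
  qed
  \<comment> \<open>For \<open>N = 0\<close> the mesh \<open>T / real N\<close> is 0 and the grid
    does not reach \<open>T\<close>.\<close>
  moreover have "\<forall>\<^sub>F i in sequentially. 1 \<le> r i"
    using filterlim_subseq[OF r] eventually_ge_at_top filterlim_iff by blast
  ultimately have err: "\<forall>\<^sub>F i in sequentially. dist (one_step_method \<Phi> x (d (r i)) (r i)) (\<phi> (w T - w 0) x)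
      \<le> C * exp (2 * (L + C) * B) * (\<Sum>k<r i. \<bar>d (r i) k\<bar> ^ 3)"
    by (auto elim: eventually_mono)
  have "(\<lambda>i. C * exp (2 * (L + C) * B) * (\<Sum>k<r i. \<bar>d (r i) k\<bar> ^ 3)) \<longlonglongrightarrow> 0"
    using tendsto_mult_left[OF cubic] by simp
  then have "(\<lambda>i. dist (one_step_method \<Phi> x (d (r i)) (r i)) (\<phi> (w T - w 0) x)) \<longlonglongrightarrow> 0"
    by (rule tendsto_sandwich[OF always_eventually err tendsto_const, rotated]) simp
  then show ?thesis by (rule tendsto_dist_iff[THEN iffD2])
qed

end

lemma tendsto_integrator:
  fixes \<Phi> :: "real \<Rightarrow> 'a::metric_space \<Rightarrow> 'a"
  assumes stab: "\<And>t1 t2 x1 x2. dist (\<Phi> t2 x2) (\<Phi> t1 x1)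
      \<le> C * (\<bar>t2 - t1\<bar> + dist x2 x1) * exp (C * (\<bar>t1\<bar> + \<bar>t2\<bar>))"
    and t: "(t \<longlongrightarrow> t\<^sub>0) G" and x: "(x \<longlongrightarrow> x\<^sub>0) G"
  shows "((\<lambda>n. \<Phi> (t n) (x n)) \<longlongrightarrow> \<Phi> t\<^sub>0 x\<^sub>0) G"
proof -
  have "((\<lambda>n. C * (\<bar>t n - t\<^sub>0\<bar> + dist (x n) x\<^sub>0) * exp (C * (\<bar>t\<^sub>0\<bar> + \<bar>t n\<bar>))) \<longlongrightarrow>
      C * (\<bar>t\<^sub>0 - t\<^sub>0\<bar> + dist x\<^sub>0 x\<^sub>0) * exp (C * (\<bar>t\<^sub>0\<bar> + \<bar>t\<^sub>0\<bar>))) G"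
    by (intro tendsto_intros t x)
  then have "((\<lambda>n. C * (\<bar>t n - t\<^sub>0\<bar> + dist (x n) x\<^sub>0) * exp (C * (\<bar>t\<^sub>0\<bar> + \<bar>t n\<bar>))) \<longlongrightarrow> 0) G" by simp
  then have "((\<lambda>n. dist (\<Phi> (t n) (x n)) (\<Phi> t\<^sub>0 x\<^sub>0)) \<longlongrightarrow> 0) G"
    by (rule tendsto_sandwich[OF _ _ tendsto_const, rotated 2]) (auto intro!: always_eventually stab)
  then show ?thesis by (rule tendsto_dist_iff[THEN iffD2])
qed

text \<open>The stability bound makes \<open>\<Phi>\<close> jointly continuous, and a fixed number
  of steps is a finite composition of such maps. This is what allows \<epsilon> to vanish before the
  time step.\<close>

lemma tendsto_one_step_method:
  fixes \<Phi> :: "real \<Rightarrow> 'a::metric_space \<Rightarrow> 'a"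
  assumes stab: "\<And>t1 t2 x1 x2. dist (\<Phi> t2 x2) (\<Phi> t1 x1)
      \<le> C * (\<bar>t2 - t1\<bar> + dist x2 x1) * exp (C * (\<bar>t1\<bar> + \<bar>t2\<bar>))"
    and \<tau>: "\<And>n. ((\<lambda>k. \<tau> k n) \<longlongrightarrow> \<tau>' n) G" and x: "(x \<longlongrightarrow> x\<^sub>0) G"
  shows "((\<lambda>k. one_step_method \<Phi> (x k) (\<tau> k) n) \<longlongrightarrow> one_step_method \<Phi> x\<^sub>0 \<tau>' n) G"
  by (induction n) (simp_all add: x tendsto_integrator[OF stab \<tau>])

section \<open>Measurability and expectations\<close>

lemma measurable_one_step_method:
  fixes \<Phi> :: "real \<Rightarrow> 'a::{metric_space, second_countable_topology} \<Rightarrow> 'a"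
  assumes stab: "\<And>t1 t2 x1 x2. dist (\<Phi> t2 x2) (\<Phi> t1 x1)
      \<le> C * (\<bar>t2 - t1\<bar> + dist x2 x1) * exp (C * (\<bar>t1\<bar> + \<bar>t2\<bar>))"
    and \<tau>: "\<And>n. (\<lambda>\<omega>. \<tau> \<omega> n) \<in> borel_measurable M"
  shows "(\<lambda>\<omega>. one_step_method \<Phi> x (\<tau> \<omega>) n) \<in> borel_measurable M"
proof (induction n)
  case (Suc n)
  have "continuous_on UNIV (\<lambda>z. \<Phi> (fst z) (snd z))"
    unfolding continuous_on_def by (intro ballI tendsto_integrator[OF stab] tendsto_intros)
  from borel_measurable_continuous_Pair[OF \<tau>[of n] Suc this] show ?case by simp
qed simp

lemma (in prob_space) tendsto_torus_dp:
  fixes X Y :: "nat \<Rightarrow> 'a \<Rightarrow> 'n::finite torus"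
  assumes p: "p > 0"
    and [measurable]: "\<And>n. X n \<in> borel_measurable M" "\<And>n. Y n \<in> borel_measurable M"
      "X' \<in> borel_measurable M" "Y' \<in> borel_measurable M"
    and X: "AE \<omega> in M. (\<lambda>n. X n \<omega>) \<longlonglongrightarrow> X' \<omega>" and Y: "AE \<omega> in M. (\<lambda>n. Y n \<omega>) \<longlonglongrightarrow> Y' \<omega>"
  shows "(\<lambda>n. torus_dp M p (X n) (Y n)) \<longlonglongrightarrow> torus_dp M p X' Y'"
proof -
  obtain D where D: "\<And>a b :: 'n torus. dist a b \<le> D" using torus_bounded by blast
  have "(\<lambda>n. \<integral>\<omega>. dist (X n \<omega>) (Y n \<omega>) powr p \<partial>M) \<longlonglongrightarrow> (\<integral>\<omega>. dist (X' \<omega>) (Y' \<omega>) powr p \<partial>M)"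
  proof (rule integral_dominated_convergence)
    show "AE \<omega> in M. (\<lambda>n. dist (X n \<omega>) (Y n \<omega>) powr p) \<longlonglongrightarrow> dist (X' \<omega>) (Y' \<omega>) powr p"
      using X Y
    proof eventually_elim
      case (elim \<omega>)
      then show ?case
        \<comment> \<open>The limit distance may be 0; there the positive exponent and the
          nonnegative bases give continuity of \<open>powr\<close>.\<close>
        using p by (intro tendsto_powr' tendsto_dist tendsto_const) auto
    qed
    show "AE \<omega> in M. norm (dist (X n \<omega>) (Y n \<omega>) powr p) \<le> D powr p" for n
      using D p by (auto intro!: AE_I2 powr_mono2)
  qed auto
  then show ?thesis
    unfolding torus_dp_def using p
    by (intro tendsto_powr' tendsto_const) (auto intro!: always_eventually integral_nonneg_AE)
qed

lemma torus_dp_self: "torus_dp M p X X = 0"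
  by (simp add: torus_dp_def)

text \<open>Almost sure convergence is available only along subsequences, but the values of
  \<open>torus_dp\<close> are plain numbers, so the whole sequence is recovered.\<close>

lemma tendsto_zero_if_subseq:
  fixes a :: "nat \<Rightarrow> real"
  assumes "\<And>r. strict_mono r \<Longrightarrow> \<exists>s. strict_mono (s :: nat \<Rightarrow> nat) \<and> (\<lambda>n. a (r (s n))) \<longlonglongrightarrow> 0"
  shows "a \<longlonglongrightarrow> 0"
proof (rule ccontr)
  assume "\<not> a \<longlonglongrightarrow> 0"
  then obtain e where e: "e > 0" "\<not> (\<forall>\<^sub>F n in sequentially. dist (a n) 0 < e)"
    unfolding tendsto_iff by blast
  then obtain r :: "nat \<Rightarrow> nat" where r: "strict_mono r" "\<And>n. \<not> dist (a (r n)) 0 < e"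
    using not_eventually_sequentiallyD by blast
  then obtain s :: "nat \<Rightarrow> nat" where "(\<lambda>n. a (r (s n))) \<longlonglongrightarrow> 0" using assms by blast
  then have "\<forall>\<^sub>F n in sequentially. dist (a (r (s n))) 0 < e" using e(1) by (rule tendstoD)
  then show False using r(2) by simp
qed

lemma (in prob_space) normal_abs_moment_3:
  assumes Y: "distributed M lborel Y (normal_density 0 \<sigma>)" and \<sigma>: "\<sigma> > 0"
  shows "integrable M (\<lambda>\<omega>. \<bar>Y \<omega>\<bar> ^ 3)" "expectation (\<lambda>\<omega>. \<bar>Y \<omega>\<bar> ^ 3) = 2 * sqrt (2 / pi) * \<sigma> ^ 3"
proof -
  \<comment> \<open>The absolute moment of order \<open>2 * k + 1\<close> at \<open>k = 1\<close>,
    where \<open>2 ^ k * fact k\<close> is 2.\<close>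
  have *: "has_bochner_integral lborel (\<lambda>x. normal_density 0 \<sigma> x * \<bar>x\<bar> ^ 3) (2 * sqrt (2 / pi) * \<sigma> ^ 3)"
    using normal_moment_abs_odd[OF \<sigma>, of 0 1] by (simp add: mult_ac)
  show "integrable M (\<lambda>\<omega>. \<bar>Y \<omega>\<bar> ^ 3)"
    using distributed_integrable[OF Y, of "\<lambda>x. \<bar>x\<bar> ^ 3"] * by (auto simp: has_bochner_integral_iff)
  show "expectation (\<lambda>\<omega>. \<bar>Y \<omega>\<bar> ^ 3) = 2 * sqrt (2 / pi) * \<sigma> ^ 3"
    using distributed_integral[OF Y, of "\<lambda>x. \<bar>x\<bar> ^ 3"] * by (auto simp: has_bochner_integral_iff)
qed

text \<open>Each of the \<open>N\<close> increments contributes a multiple of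
  \<open>(T/N)^(3/2)\<close>, so the expected sum is of order \<open>N^(-1/2)\<close>.\<close>

lemma (in prob_space) wiener_cubic_variation:
  assumes \<beta>: "wiener_process M F \<beta>" and T: "T > 0"
  defines "Z \<equiv> \<lambda>N \<omega>. \<Sum>k<N. \<bar>\<beta> (real (Suc k) * (T / real N)) \<omega> - \<beta> (real k * (T / real N)) \<omega>\<bar> ^ 3"
  shows "integrable M (Z N)" "(\<lambda>N. \<integral>\<omega>. norm (Z N \<omega>) \<partial>M) \<longlonglongrightarrow> 0"
proof -
  define c where "c = 2 * sqrt (2 / pi)"
  have moment: "integrable M (\<lambda>\<omega>. \<bar>\<beta> (real (Suc k) * (T / real N)) \<omega> - \<beta> (real k * (T / real N)) \<omega>\<bar> ^ 3)"
    "expectation (\<lambda>\<omega>. \<bar>\<beta> (real (Suc k) * (T / real N)) \<omega> - \<beta> (real k * (T / real N)) \<omega>\<bar> ^ 3)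
      = c * sqrt (T / real N) ^ 3" if "k < N" for k N
  proof -
    have h: "T / real N > 0" using T that by simp
    have "real (Suc k) * (T / real N) - real k * (T / real N) = T / real N"
      by (simp add: distrib_right add_divide_distrib)
    moreover have "real k * (T / real N) < real (Suc k) * (T / real N)"
      using h by (intro mult_strict_right_mono) auto
    moreover have "0 \<le> real k * (T / real N)" using T by simp
    ultimately have "distributed M lborel
        (\<lambda>\<omega>. \<beta> (real (Suc k) * (T / real N)) \<omega> - \<beta> (real k * (T / real N)) \<omega>)
        (normal_density 0 (sqrt (T / real N)))"
      using \<beta> unfolding wiener_process_def by metis
    from normal_abs_moment_3[OF this] h
    show "integrable M (\<lambda>\<omega>. \<bar>\<beta> (real (Suc k) * (T / real N)) \<omega> - \<beta> (real k * (T / real N)) \<omega>\<bar> ^ 3)"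
      "expectation (\<lambda>\<omega>. \<bar>\<beta> (real (Suc k) * (T / real N)) \<omega> - \<beta> (real k * (T / real N)) \<omega>\<bar> ^ 3)
        = c * sqrt (T / real N) ^ 3"
      by (simp_all add: c_def)
  qed
  show "integrable M (Z N)" for N
    unfolding Z_def by (intro Bochner_Integration.integrable_sum moment) auto
  have "(\<integral>\<omega>. norm (Z N \<omega>) \<partial>M) = c * T * sqrt (T / real N)" if "1 \<le> N" for N
  proof -
    have "(\<integral>\<omega>. norm (Z N \<omega>) \<partial>M) = (\<integral>\<omega>. Z N \<omega> \<partial>M)"
      by (intro Bochner_Integration.integral_cong) (auto simp: Z_def sum_nonneg)
    also have "\<dots> = (\<Sum>k<N. c * sqrt (T / real N) ^ 3)"
      unfolding Z_def using moment by (subst Bochner_Integration.integral_sum) auto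
    also have "\<dots> = c * (real N * (sqrt (T / real N))\<^sup>2) * sqrt (T / real N)"
      by (simp add: power3_eq_cube power2_eq_square)
    also have "real N * (sqrt (T / real N))\<^sup>2 = T" using T that by simp
    finally show ?thesis .
  qed
  then have "\<forall>\<^sub>F N in sequentially. c * T * sqrt (T / real N) = (\<integral>\<omega>. norm (Z N \<omega>) \<partial>M)"
    by (intro eventually_sequentiallyI[of 1]) simp
  moreover have "(\<lambda>N. c * T * sqrt (T / real N)) \<longlonglongrightarrow> c * T * sqrt 0"
    by (intro tendsto_intros lim_const_over_n)
  ultimately show "(\<lambda>N. \<integral>\<omega>. norm (Z N \<omega>) \<partial>M) \<longlonglongrightarrow> 0"
    using Lim_transform_eventually by fastforce
qed

theorem proposition3p6:
  fixes \<sigma> :: "'n::finite torus \<Rightarrow> real ^ 'n"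
    and \<phi> \<Phi> :: "real \<Rightarrow> 'n torus \<Rightarrow> 'n torus"
    and M :: "'w measure" and F :: "real \<Rightarrow> 'w measure" and \<beta> :: "real \<Rightarrow> 'w \<Rightarrow> real"
    and \<epsilon>\<^sub>0 :: real
    and x\<^sub>0 :: "real \<Rightarrow> 'n torus" and m\<^sub>0 :: "real \<Rightarrow> real" and x\<^sub>0\<^sub>0 :: "'n torus"
    and X :: "real \<Rightarrow> real \<Rightarrow> 'w \<Rightarrow> 'n torus" and m :: "real \<Rightarrow> real \<Rightarrow> 'w \<Rightarrow> real"
    and Xnum :: "real \<Rightarrow> real \<Rightarrow> nat \<Rightarrow> 'w \<Rightarrow> 'n torus" and mnum :: "real \<Rightarrow> real \<Rightarrow> nat \<Rightarrow> 'w \<Rightarrow> real"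
  assumes "usual_conditions M F"
    and "wiener_process M F \<beta>"
    and "\<epsilon>\<^sub>0 > 0"
    and "C_k 3 (\<lambda>y. \<sigma> (torus_of y))"
    and "(x\<^sub>0 \<longlongrightarrow> x\<^sub>0\<^sub>0) (at_right 0)"
    and "bdd_above ((\<lambda>\<epsilon>. \<bar>m\<^sub>0 \<epsilon>\<bar>) ` {0<..<\<epsilon>\<^sub>0})"
    and "torus_flow \<sigma> \<phi>"
    and "second_order_integrator \<phi> \<Phi>"
    and "\<forall>\<epsilon>\<in>{0<..<\<epsilon>\<^sub>0}. multiscale_solution M F \<beta> \<sigma> \<epsilon> (x\<^sub>0 \<epsilon>) (m\<^sub>0 \<epsilon>) (X \<epsilon>) (m \<epsilon>)"
    and "\<forall>\<epsilon>\<in>{0<..<\<epsilon>\<^sub>0}. \<forall>\<Delta>t>0.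
           scheme_solution M \<beta> \<Phi> \<epsilon> \<Delta>t (x\<^sub>0 \<epsilon>) (m\<^sub>0 \<epsilon>) (Xnum \<epsilon> \<Delta>t) (mnum \<epsilon> \<Delta>t)"
  shows "\<forall>p\<ge>1. \<forall>T>0.
    (\<exists>L. (\<forall>\<epsilon>\<in>{0<..<\<epsilon>\<^sub>0}. (\<lambda>N. torus_dp M p (Xnum \<epsilon> (T / real N) N) (X \<epsilon> T)) \<longlonglongrightarrow> L \<epsilon>)
       \<and> (L \<longlongrightarrow> 0) (at_right 0))
  \<and> (\<exists>L. (\<forall>N\<ge>1. ((\<lambda>\<epsilon>. torus_dp M p (Xnum \<epsilon> (T / real N) N) (X \<epsilon> T)) \<longlongrightarrow> L N) (at_right 0))
       \<and> L \<longlonglongrightarrow> 0)"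
proof (intro allI impI)
  fix p T :: real
  assume p: "1 \<le> p" and T: "0 < T"
  obtain L where L: "0 \<le> L" "\<And>x y. norm (\<sigma> x - \<sigma> y) \<le> L * dist x y"
    using torus_C_k_Suc_lipschitz[OF assms(4)[unfolded numeral_3_eq_3]] by blast
  interpret lipschitz_torus_flow \<sigma> \<phi> L
    using L assms(7) by unfold_locales
  interpret prob_space M
    using assms(1) by (simp add: usual_conditions_def)
  obtain C where C: "C > 0"
    and local_error: "\<And>t x. dist (\<Phi> t x) (\<phi> t x) \<le> C * \<bar>t\<bar> ^ 3 * exp (C * \<bar>t\<bar>)"
    and stab: "\<And>t1 t2 x1 x2. dist (\<Phi> t2 x2) (\<Phi> t1 x1)
      \<le> C * (\<bar>t2 - t1\<bar> + dist x2 x1) * exp (C * (\<bar>t1\<bar> + \<bar>t2\<bar>))"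
    using assms(8) unfolding second_order_integrator_def by blast
  have sub: "subalgebra M (F t)" if "0 \<le> t" for t
    using assms(1) that by (simp add: usual_conditions_def)
  have \<beta>_meas: "\<beta> t \<in> borel_measurable M" if "0 \<le> t" for t
    using conjunct1[OF assms(2)[unfolded wiener_process_def]] that
    by (intro measurable_from_subalg[OF sub[OF that]]) simp
  have \<beta>_cont: "AE \<omega> in M. continuous_on {0..} (\<lambda>t. \<beta> t \<omega>)"
    using assms(2) unfolding wiener_process_def by auto
  have X_meas: "X \<epsilon> T \<in> borel_measurable M" if "\<epsilon> \<in> {0<..<\<epsilon>\<^sub>0}" for \<epsilon>
    using bspec[OF assms(9) that] T
    by (intro measurable_from_subalg[OF sub[OF less_imp_le[OF T]]]) (simp add: multiscale_solution_def)
  \<comment> \<open>All pathwise facts at one \<epsilon>; from here on the path of \<open>X\<close>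
    enters only through its representation by the flow.\<close>
  define good where "good \<epsilon> \<omega> \<longleftrightarrow> continuous_on {0..} (\<lambda>t. m \<epsilon> t \<omega>) \<and>
      (\<forall>t\<ge>0. m \<epsilon> t \<omega> = m\<^sub>0 \<epsilon> - integral {0..t} (\<lambda>s. m \<epsilon> s \<omega> / \<epsilon>\<^sup>2) + (\<beta> t \<omega> - \<beta> 0 \<omega>) / \<epsilon>) \<and>
      X \<epsilon> T \<omega> = \<phi> (\<epsilon> * (m\<^sub>0 \<epsilon> - m \<epsilon> T \<omega>) + (\<beta> T \<omega> - \<beta> 0 \<omega>)) (x\<^sub>0 \<epsilon>)" for \<epsilon> \<omega>
  have good: "AE \<omega> in M. good \<epsilon> \<omega>" if \<epsilon>: "\<epsilon> \<in> {0<..<\<epsilon>\<^sub>0}" for \<epsilon>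
  proof -
    have "AE \<omega> in M. X \<epsilon> 0 \<omega> = x\<^sub>0 \<epsilon> \<and>
        (\<forall>t\<ge>0. has_torus_derivative (\<lambda>s. X \<epsilon> s \<omega>)
                  (\<lambda>h. h *\<^sub>R ((m \<epsilon> t \<omega> / \<epsilon>) *\<^sub>R \<sigma> (X \<epsilon> t \<omega>))) t {0..}) \<and>
        continuous_on {0..} (\<lambda>t. m \<epsilon> t \<omega>) \<and>
        (\<forall>t\<ge>0. m \<epsilon> t \<omega> = m\<^sub>0 \<epsilon> - integral {0..t} (\<lambda>s. m \<epsilon> s \<omega> / \<epsilon>\<^sup>2) + (\<beta> t \<omega> - \<beta> 0 \<omega>) / \<epsilon>)"
      using bspec[OF assms(9) \<epsilon>] unfolding multiscale_solution_def by (rule conjunct2)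
    then show ?thesis
    proof eventually_elim
      case (elim \<omega>)
      then have X0: "X \<epsilon> 0 \<omega> = x\<^sub>0 \<epsilon>" and cont: "continuous_on {0..} (\<lambda>t. m \<epsilon> t \<omega>)"
        and X': "\<And>t. 0 \<le> t \<Longrightarrow> has_torus_derivative (\<lambda>s. X \<epsilon> s \<omega>)
                  (\<lambda>h. h *\<^sub>R ((m \<epsilon> t \<omega> / \<epsilon>) *\<^sub>R \<sigma> (X \<epsilon> t \<omega>))) t {0..}"
        and eq: "\<And>t. 0 \<le> t \<Longrightarrow> m \<epsilon> t \<omega> = m\<^sub>0 \<epsilon> - integral {0..t} (\<lambda>s. m \<epsilon> s \<omega> / \<epsilon>\<^sup>2)
                  + (\<beta> t \<omega> - \<beta> 0 \<omega>) / \<epsilon>"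
        by blast+
      have "0 < \<epsilon>" using \<epsilon> by simp
      from position_eq_flow[where w="\<lambda>t. \<beta> t \<omega>", OF this less_imp_le[OF T] cont eq[OF less_imp_le[OF T]] X']
      have "X \<epsilon> T \<omega> = \<phi> (\<epsilon> * (m\<^sub>0 \<epsilon> - m \<epsilon> T \<omega>) + (\<beta> T \<omega> - \<beta> 0 \<omega>)) (x\<^sub>0 \<epsilon>)"
        unfolding X0 .
      then show ?case
        unfolding good_def using cont eq by blast
    qed
  qed
  define step where "step \<epsilon> h \<omega> k = h * mnum \<epsilon> h (Suc k) \<omega> / \<epsilon>" for \<epsilon> h \<omega> k
  define d where "d N \<omega> k = \<beta> (real (Suc k) * (T / real N)) \<omega> - \<beta> (real k * (T / real N)) \<omega>"
    for N :: nat and \<omega> k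
  have scheme: "mnum \<epsilon> h 0 \<omega> = m\<^sub>0 \<epsilon>"
    "mnum \<epsilon> h (Suc n) \<omega> = mnum \<epsilon> h n \<omega> - h / \<epsilon>\<^sup>2 * mnum \<epsilon> h (Suc n) \<omega>
        + (\<beta> (real (Suc n) * h) \<omega> - \<beta> (real n * h) \<omega>) / \<epsilon>"
    "Xnum \<epsilon> h n \<omega> = one_step_method \<Phi> (x\<^sub>0 \<epsilon>) (step \<epsilon> h \<omega>) n"
    if "\<epsilon> \<in> {0<..<\<epsilon>\<^sub>0}" "h > 0" "\<omega> \<in> space M" for \<epsilon> h \<omega> n
  proof -
    have "scheme_solution M \<beta> \<Phi> \<epsilon> h (x\<^sub>0 \<epsilon>) (m\<^sub>0 \<epsilon>) (Xnum \<epsilon> h) (mnum \<epsilon> h)"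
      using bspec[OF assms(10) that(1)] that(2) by simp
    note s = bspec[OF this[unfolded scheme_solution_def] that(3)]
    note s' = spec[OF conjunct2[OF conjunct2[OF s]]]
    show "mnum \<epsilon> h 0 \<omega> = m\<^sub>0 \<epsilon>"
      by (rule conjunct1[OF conjunct2[OF s]])
    show "mnum \<epsilon> h (Suc n) \<omega> = mnum \<epsilon> h n \<omega> - h / \<epsilon>\<^sup>2 * mnum \<epsilon> h (Suc n) \<omega>
        + (\<beta> (real (Suc n) * h) \<omega> - \<beta> (real n * h) \<omega>) / \<epsilon>"
      by (rule conjunct2[OF s'])
    have "Xnum \<epsilon> h 0 \<omega> = x\<^sub>0 \<epsilon>"
      by (rule conjunct1[OF s])
    moreover have "Xnum \<epsilon> h (Suc n) \<omega> = \<Phi> (step \<epsilon> h \<omega> n) (Xnum \<epsilon> h n \<omega>)" for n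
      unfolding step_def by (rule conjunct1[OF s'])
    ultimately show "Xnum \<epsilon> h n \<omega> = one_step_method \<Phi> (x\<^sub>0 \<epsilon>) (step \<epsilon> h \<omega>) n"
      by (induction n) simp_all
  qed

  \<comment> \<open>Measurability of the scheme, of its limit and of the limit flow\<close>
  have Xnum_meas: "Xnum \<epsilon> h n \<in> borel_measurable M" if \<epsilon>: "\<epsilon> \<in> {0<..<\<epsilon>\<^sub>0}" and h: "h > 0" for \<epsilon> h n
  proof -
    \<comment> \<open>\<open>scheme_solution\<close> fixes only the values on
      \<open>space M\<close>; measurability comes from solving the implicit recursion
      explicitly.\<close>
    have m_meas: "mnum \<epsilon> h n \<in> borel_measurable M" for n
    proof (induction n)
      case 0
      show ?case
        by (subst measurable_cong[where g="\<lambda>_. m\<^sub>0 \<epsilon>"]) (simp_all add: scheme(1)[OF \<epsilon> h])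
    next
      case (Suc n)
      have "mnum \<epsilon> h (Suc n) \<omega> = (\<epsilon>\<^sup>2 * mnum \<epsilon> h n \<omega>
          + \<epsilon> * (\<beta> (real (Suc n) * h) \<omega> - \<beta> (real n * h) \<omega>)) / (\<epsilon>\<^sup>2 + h)"
        if "\<omega> \<in> space M" for \<omega>
        by (rule implicit_euler_step(1)[OF _ _ scheme(2)[OF \<epsilon> h that]]) (use \<epsilon> h in auto)
      moreover have "(\<lambda>\<omega>. (\<epsilon>\<^sup>2 * mnum \<epsilon> h n \<omega>
          + \<epsilon> * (\<beta> (real (Suc n) * h) \<omega> - \<beta> (real n * h) \<omega>)) / (\<epsilon>\<^sup>2 + h)) \<in> borel_measurable M"
        using h by (intro borel_measurable_divide borel_measurable_add borel_measurable_times
            borel_measurable_diff borel_measurable_const Suc \<beta>_meas) simp_all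
      ultimately show ?case by (simp cong: measurable_cong)
    qed
    have "(\<lambda>\<omega>. step \<epsilon> h \<omega> k) \<in> borel_measurable M" for k
      unfolding step_def using m_meas[of "Suc k"] by measurable
    then have "(\<lambda>\<omega>. one_step_method \<Phi> (x\<^sub>0 \<epsilon>) (step \<epsilon> h \<omega>) n) \<in> borel_measurable M"
      by (rule measurable_one_step_method[OF stab])
    then show ?thesis
      by (subst measurable_cong[OF scheme(3)[OF \<epsilon> h]])
  qed
  have lim_meas: "(\<lambda>\<omega>. one_step_method \<Phi> x\<^sub>0\<^sub>0 (d N \<omega>) n) \<in> borel_measurable M" for N n
  proof (rule measurable_one_step_method[OF stab])
    fix k
    show "(\<lambda>\<omega>. d N \<omega> k) \<in> borel_measurable M"
      unfolding d_def using T by (intro borel_measurable_diff \<beta>_meas) simp_all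
  qed
  have flow_meas: "(\<lambda>\<omega>. \<phi> (\<beta> T \<omega> - \<beta> 0 \<omega>) x\<^sub>0\<^sub>0) \<in> borel_measurable M"
  proof -
    have "continuous_on UNIV (\<lambda>t. \<phi> t x\<^sub>0\<^sub>0)"
      unfolding continuous_on_def by (intro ballI tendsto_flow[OF tendsto_ident_at tendsto_const])
    moreover have "(\<lambda>\<omega>. \<beta> T \<omega> - \<beta> 0 \<omega>) \<in> borel_measurable M"
      using T by (intro borel_measurable_diff \<beta>_meas) simp_all
    ultimately show ?thesis
      by (rule borel_measurable_continuous_on)
  qed

  \<comment> \<open>Inner limit in the time step, at fixed \<epsilon>\<close>
  have fixed_\<epsilon>: "(\<lambda>N. torus_dp M p (Xnum \<epsilon> (T / real N) N) (X \<epsilon> T)) \<longlonglongrightarrow> 0"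
    if \<epsilon>: "\<epsilon> \<in> {0<..<\<epsilon>\<^sub>0}" for \<epsilon>
  proof -
    \<comment> \<open>The shift to \<open>Suc N\<close> skips \<open>N = 0\<close>, where the step
      size is 0 and the scheme is unconstrained, possibly not measurable.\<close>
    have "(\<lambda>N. torus_dp M p (Xnum \<epsilon> (T / real (Suc N)) (Suc N)) (X \<epsilon> T)) \<longlonglongrightarrow> torus_dp M p (X \<epsilon> T) (X \<epsilon> T)"
    proof (rule tendsto_torus_dp)
      show "AE \<omega> in M. (\<lambda>N. Xnum \<epsilon> (T / real (Suc N)) (Suc N) \<omega>) \<longlonglongrightarrow> X \<epsilon> T \<omega>"
        using good[OF \<epsilon>] AE_space
      proof eventually_elim
        case (elim \<omega>)
        have "(\<lambda>N. one_step_method \<Phi> (x\<^sub>0 \<epsilon>) (\<lambda>k. T / real N * mnum \<epsilon> (T / real N) (Suc k) \<omega> / \<epsilon>) N)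
            \<longlonglongrightarrow> \<phi> (\<epsilon> * (m\<^sub>0 \<epsilon> - m \<epsilon> T \<omega>) + (\<beta> T \<omega> - \<beta> 0 \<omega>)) (x\<^sub>0 \<epsilon>)"
        proof (rule scheme_tendsto_solution[where m="\<lambda>t. m \<epsilon> t \<omega>" and w="\<lambda>t. \<beta> t \<omega>", OF C local_error _ T])
          fix N n :: nat assume "1 \<le> N"
          then have h: "T / real N > 0" using T by simp
          show "mnum \<epsilon> (T / real N) 0 \<omega> = m\<^sub>0 \<epsilon>"
            by (rule scheme(1)[OF \<epsilon> h elim(2)])
          show "mnum \<epsilon> (T / real N) (Suc n) \<omega> = mnum \<epsilon> (T / real N) n \<omega>
              - T / real N / \<epsilon>\<^sup>2 * mnum \<epsilon> (T / real N) (Suc n) \<omega>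
              + (\<beta> (real (Suc n) * (T / real N)) \<omega> - \<beta> (real n * (T / real N)) \<omega>) / \<epsilon>"
            by (rule scheme(2)[OF \<epsilon> h elim(2)])
        qed (use elim(1) \<epsilon> in \<open>auto simp: good_def\<close>)
        from LIMSEQ_Suc[OF this]
        have "(\<lambda>N. one_step_method \<Phi> (x\<^sub>0 \<epsilon>) (step \<epsilon> (T / real (Suc N)) \<omega>) (Suc N)) \<longlonglongrightarrow> X \<epsilon> T \<omega>"
          using elim(1) unfolding good_def step_def by (simp only:)
        moreover have "Xnum \<epsilon> (T / real (Suc N)) (Suc N) \<omega>
            = one_step_method \<Phi> (x\<^sub>0 \<epsilon>) (step \<epsilon> (T / real (Suc N)) \<omega>) (Suc N)" for N
          by (rule scheme(3)[OF \<epsilon> _ elim(2)]) (use T in simp)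
        ultimately show ?case by (simp only:)
      qed
    qed (use p T \<epsilon> in \<open>auto intro!: Xnum_meas X_meas simp del: of_nat_Suc\<close>)
    then show ?thesis
      unfolding torus_dp_self by (rule LIMSEQ_imp_Suc)
  qed

  \<comment> \<open>Inner limit in \<epsilon>, at a fixed number of steps\<close>
  let ?L = "\<lambda>N. torus_dp M p (\<lambda>\<omega>. one_step_method \<Phi> x\<^sub>0\<^sub>0 (d N \<omega>) N) (\<lambda>\<omega>. \<phi> (\<beta> T \<omega> - \<beta> 0 \<omega>) x\<^sub>0\<^sub>0)"
  have small_\<epsilon>: "((\<lambda>\<epsilon>. torus_dp M p (Xnum \<epsilon> (T / real N) N) (X \<epsilon> T)) \<longlongrightarrow> ?L N) (at_right 0)"
    if N: "1 \<le> N" for N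
  \<comment> \<open>Along a sequence only countably many exceptional null sets have to be removed,
    and dominated convergence applies.\<close>
  proof (rule tendsto_at_right_sequentially[OF assms(3)])
    fix \<epsilon> :: "nat \<Rightarrow> real"
    assume eps: "\<And>k. 0 < \<epsilon> k" "\<And>k. \<epsilon> k < \<epsilon>\<^sub>0" "\<epsilon> \<longlonglongrightarrow> 0"
    then have \<epsilon>: "\<epsilon> k \<in> {0<..<\<epsilon>\<^sub>0}" for k by simp
    have h: "T / real N > 0" using T N by simp
    obtain K where "\<forall>e\<in>{0<..<\<epsilon>\<^sub>0}. \<bar>m\<^sub>0 e\<bar> \<le> K"
      using assms(6) unfolding bdd_above_def by blast
    then have K: "\<bar>m\<^sub>0 (\<epsilon> k)\<bar> \<le> K" for k
      using \<epsilon> by blast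
    have m0: "(\<lambda>k. \<epsilon> k * m\<^sub>0 (\<epsilon> k)) \<longlonglongrightarrow> 0"
    proof (rule Lim_null_comparison)
      show "\<forall>\<^sub>F k in sequentially. norm (\<epsilon> k * m\<^sub>0 (\<epsilon> k)) \<le> \<epsilon> k * K"
        using K eps(1) by (intro always_eventually allI) (simp add: abs_mult mult_left_mono less_imp_le)
      show "(\<lambda>k. \<epsilon> k * K) \<longlonglongrightarrow> 0"
        using tendsto_mult_right[OF eps(3), of K] by simp
    qed
    have "filterlim \<epsilon> (at_right 0) sequentially"
      using eps by (intro tendsto_imp_filterlim_at_right always_eventually) auto
    then have x0: "(\<lambda>k. x\<^sub>0 (\<epsilon> k)) \<longlonglongrightarrow> x\<^sub>0\<^sub>0"
      by (rule filterlim_compose[OF assms(5)])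
    have all_good: "AE \<omega> in M. \<forall>k. good (\<epsilon> k) \<omega>"
      unfolding AE_all_countable by (intro allI good \<epsilon>)
    show "(\<lambda>k. torus_dp M p (Xnum (\<epsilon> k) (T / real N) N) (X (\<epsilon> k) T)) \<longlonglongrightarrow> ?L N"
    proof (rule tendsto_torus_dp)
      show "AE \<omega> in M. (\<lambda>k. Xnum (\<epsilon> k) (T / real N) N \<omega>) \<longlonglongrightarrow> one_step_method \<Phi> x\<^sub>0\<^sub>0 (d N \<omega>) N"
        using AE_space
      proof eventually_elim
        case (elim \<omega>)
        have "(\<lambda>k. step (\<epsilon> k) (T / real N) \<omega> n) \<longlonglongrightarrow> d N \<omega> n" for n
          unfolding step_def
        proof (rule scheme_step_limit[OF eps(1,3) h])
          show "(\<lambda>k. \<epsilon> k * mnum (\<epsilon> k) (T / real N) 0 \<omega>) \<longlonglongrightarrow> 0"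
            using m0 by (simp add: scheme(1)[OF \<epsilon> h elim])
          show "mnum (\<epsilon> k) (T / real N) (Suc n) \<omega> = mnum (\<epsilon> k) (T / real N) n \<omega>
              - T / real N / (\<epsilon> k)\<^sup>2 * mnum (\<epsilon> k) (T / real N) (Suc n) \<omega> + d N \<omega> n / \<epsilon> k" for k n
            unfolding d_def by (rule scheme(2)[OF \<epsilon> h elim])
        qed
        then show ?case
          unfolding scheme(3)[OF \<epsilon> h elim] by (rule tendsto_one_step_method[OF stab _ x0])
      qed
      show "AE \<omega> in M. (\<lambda>k. X (\<epsilon> k) T \<omega>) \<longlonglongrightarrow> \<phi> (\<beta> T \<omega> - \<beta> 0 \<omega>) x\<^sub>0\<^sub>0"
        using all_good \<beta>_cont
      proof eventually_elim
        case (elim \<omega>)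
        have "(\<lambda>k. \<epsilon> k * m (\<epsilon> k) T \<omega>) \<longlonglongrightarrow> 0"
          by (rule velocity_relaxation[where m="\<lambda>k t. m (\<epsilon> k) t \<omega>" and w="\<lambda>t. \<beta> t \<omega>", OF eps(1,3) T _ _ m0])
            (use elim in \<open>auto simp: good_def\<close>)
        from solution_tendsto_flow[OF this m0 x0, of "\<beta> T \<omega> - \<beta> 0 \<omega>"]
        show ?case using elim(1) by (simp add: good_def)
      qed
    qed (use p in \<open>auto intro!: Xnum_meas[OF \<epsilon> h] X_meas[OF \<epsilon>] lim_meas flow_meas\<close>)
  qed

  \<comment> \<open>Outer limit: the scheme driven by Brownian increments\<close>
  have "?L \<longlonglongrightarrow> 0"
  proof (rule tendsto_zero_if_subseq)
    fix r :: "nat \<Rightarrow> nat" assume r: "strict_mono r"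
    let ?Z = "\<lambda>N \<omega>. \<Sum>k<N. \<bar>d N \<omega> k\<bar> ^ 3"
    note Z = wiener_cubic_variation[OF assms(2) T, folded d_def]
    obtain s :: "nat \<Rightarrow> nat" where s: "strict_mono s" "AE \<omega> in M. (\<lambda>n. ?Z (r (s n)) \<omega>) \<longlonglongrightarrow> 0"
      using tendsto_L1_AE_subseq[of M "\<lambda>n. ?Z (r n)"] Z(1) LIMSEQ_subseq_LIMSEQ[OF Z(2) r]
      by (auto simp: o_def)
    have rs: "strict_mono (\<lambda>n. r (s n))"
      using strict_mono_o[OF r s(1)] by (simp add: o_def)
    have "(\<lambda>n. ?L (r (s n))) \<longlonglongrightarrow> torus_dp M p (\<lambda>\<omega>. \<phi> (\<beta> T \<omega> - \<beta> 0 \<omega>) x\<^sub>0\<^sub>0) (\<lambda>\<omega>. \<phi> (\<beta> T \<omega> - \<beta> 0 \<omega>) x\<^sub>0\<^sub>0)"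
    proof (rule tendsto_torus_dp)
      show "AE \<omega> in M. (\<lambda>n. one_step_method \<Phi> x\<^sub>0\<^sub>0 (d (r (s n)) \<omega>) (r (s n))) \<longlonglongrightarrow> \<phi> (\<beta> T \<omega> - \<beta> 0 \<omega>) x\<^sub>0\<^sub>0"
        using s(2) \<beta>_cont
      proof eventually_elim
        case (elim \<omega>)
        then show ?case
          unfolding d_def
          by (intro limit_scheme_tendsto_flow[where w="\<lambda>t. \<beta> t \<omega>" and r="\<lambda>n. r (s n)", OF C local_error T _ rs])
      qed
    qed (use p in \<open>auto intro!: lim_meas flow_meas\<close>)
    then show "\<exists>s. strict_mono (s :: nat \<Rightarrow> nat) \<and> (\<lambda>n. ?L (r (s n))) \<longlonglongrightarrow> 0"
      using s(1) unfolding torus_dp_self by blast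
  qed
  with small_\<epsilon> fixed_\<epsilon> show "(\<exists>L. (\<forall>\<epsilon>\<in>{0<..<\<epsilon>\<^sub>0}. (\<lambda>N. torus_dp M p (Xnum \<epsilon> (T / real N) N) (X \<epsilon> T)) \<longlonglongrightarrow> L \<epsilon>)
       \<and> (L \<longlongrightarrow> 0) (at_right 0))
  \<and> (\<exists>L. (\<forall>N\<ge>1. ((\<lambda>\<epsilon>. torus_dp M p (Xnum \<epsilon> (T / real N) N) (X \<epsilon> T)) \<longlongrightarrow> L N) (at_right 0))
       \<and> L \<longlonglongrightarrow> 0)"
    \<comment> \<open>At each fixed \<epsilon> the inner limit is already zero, so the first witness
      is the zero function.\<close>
    by (intro conjI exI[of _ "\<lambda>_. 0"] exI[of _ ?L]) auto
qed

end
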